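(* Let $X$ be a locally compact Hausdorff space, let $E$ be a quasi-perfect partially ordered vector space, and let $\pi:\mathrm{C}_0(X)\to E$ be a positive operator. Then there exists a unique regular Borel measure $\mu:\mathscr{B}\to\overline{E^+}$ on the Borel $\sigma$-algebra $\mathscr{B}$ of $X$ such that \[ \pi(f)=\int_X^{\mathrm{o}} f\,\mathrm{d}\mu \] for all $f\in\mathrm{C}_{\mathrm c}(X)$. The measure $\mu$ is finite, and the equation $\pi(f)=\int_X^{\mathrm{o}} f\,\mathrm{d}\mu$ also holds for all $f\in\mathrm{C}_0(X)$. If $V$ is a non-empty open subset of $X$, then \[ \mu(V)=\bigvee\{\pi(f): f\prec V\} \] in $E$. If $K$ is a compact subset of $X$, then \[ \mu(K)=\bigwedge\{\pi(f): K\prec f\} \] in $E$.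
   Context: Ordered spaces. Vector spaces are real; operators and functionals are linear. A partially ordered vector space $E$ has a proper positive cone $E^+$, which need not be generating. An operator is positive if it maps the positive cone into the positive cone. $E^{\sim}$ is the space of differences of positive functionals on $E$, and $(E^\sim)^+$ is the set of positive functionals. A positive functional $x'$ on $E$ is order continuous if $(x_\lambda,x')\downarrow 0$ for every net $x_\lambda\downarrow0$ in $E$ (decreasing with infimum $0$). $E_{\mathrm{oc}}^{\sim}$ is the space of differences of positive order continuous functionals, and $(E_{\mathrm{oc}}^{\sim})^+$ is the set of positive order continuous functionals. $E$ is normal if, for $x\in E$, one has $(x,x')\ge0$ for all $x'\in(E_{\mathrm{oc}}^{\sim})^+$ if and only if $x\in E^+$. $E$ is quasi-perfect if (1) $E$ is normal, and (2) whenever an increasing net $\{x_\lambda\}$ in $E^+$ is such that $\sup_\lambda(x_\lambda,x')<\infty$ for each $x'\in(E^\sim)^+$, then this net has a supremum in $E$. (A quasi-perfect space is monotone complete: every increasing net in $E$ that is bounded above has a supremum.) Extended space. $\overline{E}=E\cup\{\infty\}$ (disjoint union), ordered by the order of $E$ and $x\le\infty$ for all $x\in\overline E$; $\overline{E^+}=E^+\cup\{\infty\}$; $\infty+x=x+\infty=\infty$; $r\cdot\infty=\infty$ for real $r>0$, $0\cdot\infty=0$. Elements of $E$ are called finite. Measures. A positive $\overline E$-valued measure on $\mathscr{B}$ is a map $\mu:\mathscr{B}\to\overline{E^+}$ with $\mu(\emptyset)=0$ and $\mu(\bigcup_n\Delta_n)=\bigvee_{N=1}^\infty\sum_{n=1}^N\mu(\Delta_n)$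 in $\overline E$ for pairwise disjoint sequences $(\Delta_n)$ in $\mathscr{B}$. It is finite if $\mu(X)\in E^+$. Order integral. For a measurable $\varphi=\sum_{i=1}^n r_i\chi_{\Delta_i}\ge 0$ taking finitely many finite values ($r_i\in\mathbb{R}^+$, $\Delta_i\in\mathscr{B}$), $\int_X^{\mathrm o}\varphi\,\mathrm d\mu=\sum_i r_i\mu(\Delta_i)\in\overline{E^+}$. For measurable $f:X\to[0,\infty]$, $\int_X^{\mathrm o}f\,\mathrm d\mu=\bigvee_n\int_X^{\mathrm o}\varphi_n\,\mathrm d\mu$ in $\overline{E}$, for any sequence of such elementary functions $\varphi_n\uparrow f$ pointwise (independent of the choice). A measurable $f:X\to\mathbb{R}$ is integrable if $\int_X^{\mathrm o}|f|\,\mathrm d\mu$ is finite, and then $\int_X^{\mathrm o}f\,\mathrm d\mu=\int_X^{\mathrm o}f^+\,\mathrm d\mu-\int_X^{\mathrm o}f^-\,\mathrm d\mu$. Regularity. $\mu$ is a Borel measure if $\mu(K)\in E$ for all compact $K\subseteq X$; it is inner regular at $\Delta$ if $\mu(\Delta)=\bigvee\{\mu(K):K\text{ compact},K\subseteq\Delta\}$ in $\overline E$; outer regular at $\Delta$ if $\mu(\Delta)=\bigwedge\{\mu(V):V\text{ open},\Delta\subseteq V\}$ in $\overline E$. It is a regular Borel measure if it is a Borel measure that is inner regular at all open sets and outer regular at all Borel sets. Functions. $\mathrm{C}_{\mathrm c}(X)$ (resp. $\mathrm{C}_0(X)$) is the space of real-valued continuous functions on $X$ with compact support (resp. vanishing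 at infinity), with the pointwise order. For $S\subseteq X$, $f\prec S$ means $f\in\mathrm{C}_{\mathrm c}(X)$, $0\le f\le 1$ and $\operatorname{supp}f\subseteq S$; $S\prec f$ means $f\in\mathrm{C}_{\mathrm c}(X)$, $0\le f\le 1$ and $f=1$ on $S$. *)

theory Defs
  imports "HOL-Analysis.Analysis" "HOL-Library.Lub_Glb"
begin

section \<open>Partially ordered vector spaces\<close>

text \<open>
  Partially ordered vector spaces are types of class \<^class>\<open>ordered_real_vector\<close>; the positive cone
  \<open>{x. 0 \<le> x}\<close> is proper by antisymmetry and need not be generating.  Suprema and infima in a
  partially ordered type are expressed by \<open>isLub UNIV S x\<close> and \<open>isGlb UNIV S x\<close>.

  Monotone nets are represented by their ranges.  The range of an increasing net is an
  upward directed set with the same upper bounds (hence the same supremum), and an upward directed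
  set is an increasing net indexed by itself; dually for decreasing nets.  If \<open>f\<close> is a monotone
  function, then \<open>f ` D\<close> is the range of the image net.  This avoids quantifying over index types.
\<close>

definition up_directed :: "'a::order set \<Rightarrow> bool"
  where "up_directed D \<longleftrightarrow> D \<noteq> {} \<and> (\<forall>x\<in>D. \<forall>y\<in>D. \<exists>z\<in>D. x \<le> z \<and> y \<le> z)"

definition down_directed :: "'a::order set \<Rightarrow> bool"
  where "down_directed D \<longleftrightarrow> D \<noteq> {} \<and> (\<forall>x\<in>D. \<forall>y\<in>D. \<exists>z\<in>D. z \<le> x \<and> z \<le> y)"

definition positive_functional :: "('e::ordered_real_vector \<Rightarrow> real) \<Rightarrow> bool"
  where "positive_functional x' \<longleftrightarrow> linear x' \<and> (\<forall>x\<ge>0. 0 \<le> x' x)"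

definition positive_oc_functional :: "('e::ordered_real_vector \<Rightarrow> real) \<Rightarrow> bool"
  where "positive_oc_functional x' \<longleftrightarrow> positive_functional x' \<and>
    (\<forall>D. down_directed D \<longrightarrow> isGlb UNIV D 0 \<longrightarrow> isGlb UNIV (x' ` D) 0)"

definition normal_space_ov :: "'e::ordered_real_vector itself \<Rightarrow> bool"
  where "normal_space_ov _ \<longleftrightarrow>
    (\<forall>x::'e. (\<forall>x'. positive_oc_functional x' \<longrightarrow> 0 \<le> x' x) \<longleftrightarrow> 0 \<le> x)"

definition quasi_perfect :: "'e::ordered_real_vector itself \<Rightarrow> bool"
  where "quasi_perfect T \<longleftrightarrow> normal_space_ov T \<and>
    (\<forall>D::'e set. up_directed D \<longrightarrow> (\<forall>x\<in>D. 0 \<le> x) \<longrightarrow>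
       (\<forall>x'. positive_functional x' \<longrightarrow> bdd_above (x' ` D)) \<longrightarrow> (\<exists>s. isLub UNIV D s))"


section \<open>The extended space\<close>

datatype 'e ext = Fin 'e | Infty

instantiation ext :: (order) order
begin

fun less_eq_ext :: "'a ext \<Rightarrow> 'a ext \<Rightarrow> bool" where
  "less_eq_ext _ Infty \<longleftrightarrow> True"
| "less_eq_ext Infty (Fin _) \<longleftrightarrow> False"
| "less_eq_ext (Fin x) (Fin y) \<longleftrightarrow> x \<le> y"

definition less_ext :: "'a ext \<Rightarrow> 'a ext \<Rightarrow> bool"
  where "less_ext x y \<longleftrightarrow> x \<le> y \<and> \<not> y \<le> x"

instance
proof
  fix x y z :: "'a ext"
  show "x < y \<longleftrightarrow> x \<le> y \<and> \<not> y \<le> x" by (rule less_ext_def)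
  show "x \<le> x" by (cases x) auto
  show "x \<le> y \<Longrightarrow> y \<le> z \<Longrightarrow> x \<le> z" by (cases x; cases y; cases z) auto
  show "x \<le> y \<Longrightarrow> y \<le> x \<Longrightarrow> x = y" by (cases x; cases y) auto
qed

end

instantiation ext :: (comm_monoid_add) comm_monoid_add
begin

definition zero_ext :: "'a ext"
  where "zero_ext = Fin 0"

fun plus_ext :: "'a ext \<Rightarrow> 'a ext \<Rightarrow> 'a ext" where
  "plus_ext (Fin x) (Fin y) = Fin (x + y)"
| "plus_ext Infty _ = Infty"
| "plus_ext _ Infty = Infty"

instance
proof
  fix x y z :: "'a ext"
  show "x + y + z = x + (y + z)" by (cases x; cases y; cases z) (auto simp: add.assoc)
  show "x + y = y + x" by (cases x; cases y) (auto simp: add.commute)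
  show "0 + x = x" by (cases x) (auto simp: zero_ext_def)
qed

end

text \<open>Only used for \<open>r \<ge> 0\<close>.\<close>

fun ext_scale :: "real \<Rightarrow> 'e::real_vector ext \<Rightarrow> 'e ext" where
  "ext_scale r (Fin x) = Fin (r *\<^sub>R x)"
| "ext_scale r Infty = (if r = 0 then 0 else Infty)"


section \<open>Measures with values in the extended positive cone\<close>

text \<open>
  A \<^typ>\<open>'a measure\<close> \<open>M\<close> only serves as the measurable space \<open>(space M, sets M)\<close>; a vector measure
  is a function on all sets, of which only the restriction to \<open>sets M\<close> is relevant.
\<close>

definition ext_measure :: "'a measure \<Rightarrow> ('a set \<Rightarrow> 'e::ordered_real_vector ext) \<Rightarrow> bool"
  where "ext_measure M \<mu> \<longleftrightarrow>
    (\<forall>\<Delta>\<in>sets M. 0 \<le> \<mu> \<Delta>) \<and> \<mu> {} = 0 \<and>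
    (\<forall>\<Delta>::nat \<Rightarrow> 'a set. range \<Delta> \<subseteq> sets M \<longrightarrow> disjoint_family \<Delta> \<longrightarrow>
       isLub UNIV (range (\<lambda>N. \<Sum>n\<le>N. \<mu> (\<Delta> n))) (\<mu> (\<Union>n. \<Delta> n)))"

definition finite_ext_measure :: "'a measure \<Rightarrow> ('a set \<Rightarrow> 'e::ordered_real_vector ext) \<Rightarrow> bool"
  where "finite_ext_measure M \<mu> \<longleftrightarrow> (\<exists>e\<ge>0. \<mu> (space M) = Fin e)"


section \<open>The order integral\<close>

definition elementary :: "'a measure \<Rightarrow> ('a \<Rightarrow> real) \<Rightarrow> bool"
  where "elementary M \<phi> \<longleftrightarrow> simple_function M \<phi> \<and> (\<forall>x\<in>space M. 0 \<le> \<phi> x)"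

text \<open>The canonical representation \<open>\<phi> = \<Sum>r. r \<chi>{\<phi> = r}\<close> is used, as in \<^const>\<open>simple_integral\<close>.\<close>

definition elementary_integral ::
    "'a measure \<Rightarrow> ('a set \<Rightarrow> 'e::ordered_real_vector ext) \<Rightarrow> ('a \<Rightarrow> real) \<Rightarrow> 'e ext"
  where "elementary_integral M \<mu> \<phi> =
    (\<Sum>r\<in>\<phi> ` space M. ext_scale r (\<mu> (\<phi> -` {r} \<inter> space M)))"

text \<open>
  The order integral of a \<open>[0,\<infinity>]\<close>-valued function, as a relation, since suprema need not exist in a
  general ordered vector space.  If increasing sequences that are bounded above have suprema (in
  particular in quasi-perfect spaces) it determines a unique value for every measurable \<open>f\<close>,
  independent of the sequence \<open>\<phi>\<close>.
\<close>

definition has_nn_order_integral ::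
    "'a measure \<Rightarrow> ('a set \<Rightarrow> 'e::ordered_real_vector ext) \<Rightarrow> ('a \<Rightarrow> ennreal) \<Rightarrow> 'e ext \<Rightarrow> bool"
  where "has_nn_order_integral M \<mu> f s \<longleftrightarrow>
    f \<in> borel_measurable M \<and>
    (\<exists>\<phi>::nat \<Rightarrow> 'a \<Rightarrow> real. (\<forall>n. elementary M (\<phi> n)) \<and>
       (\<forall>x\<in>space M. incseq (\<lambda>n. \<phi> n x) \<and> (\<lambda>n. ennreal (\<phi> n x)) \<longlonglongrightarrow> f x) \<and>
       isLub UNIV (range (\<lambda>n. elementary_integral M \<mu> (\<phi> n))) s)"

definition order_integrable ::
    "'a measure \<Rightarrow> ('a set \<Rightarrow> 'e::ordered_real_vector ext) \<Rightarrow> ('a \<Rightarrow> real) \<Rightarrow> bool"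
  where "order_integrable M \<mu> f \<longleftrightarrow> f \<in> borel_measurable M \<and>
    (\<exists>e. has_nn_order_integral M \<mu> (\<lambda>x. ennreal \<bar>f x\<bar>) (Fin e))"

definition order_integral ::
    "'a measure \<Rightarrow> ('a set \<Rightarrow> 'e::ordered_real_vector ext) \<Rightarrow> ('a \<Rightarrow> real) \<Rightarrow> 'e"
  where "order_integral M \<mu> f = (THE e. \<exists>p q.
    has_nn_order_integral M \<mu> (\<lambda>x. ennreal (max 0 (f x))) (Fin p) \<and>
    has_nn_order_integral M \<mu> (\<lambda>x. ennreal (max 0 (- f x))) (Fin q) \<and> e = p - q)"


section \<open>Regular Borel measures\<close>

definition borel_of :: "'a topology \<Rightarrow> 'a measure"
  where "borel_of X = sigma (topspace X) {U. openin X U}"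

definition inner_regular_at ::
    "'a topology \<Rightarrow> ('a set \<Rightarrow> 'e::ordered_real_vector ext) \<Rightarrow> 'a set \<Rightarrow> bool"
  where "inner_regular_at X \<mu> \<Delta> \<longleftrightarrow> isLub UNIV {\<mu> K |K. compactin X K \<and> K \<subseteq> \<Delta>} (\<mu> \<Delta>)"

definition outer_regular_at ::
    "'a topology \<Rightarrow> ('a set \<Rightarrow> 'e::ordered_real_vector ext) \<Rightarrow> 'a set \<Rightarrow> bool"
  where "outer_regular_at X \<mu> \<Delta> \<longleftrightarrow> isGlb UNIV {\<mu> V |V. openin X V \<and> \<Delta> \<subseteq> V} (\<mu> \<Delta>)"

definition borel_ext_measure ::
    "'a topology \<Rightarrow> ('a set \<Rightarrow> 'e::ordered_real_vector ext) \<Rightarrow> bool"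
  where "borel_ext_measure X \<mu> \<longleftrightarrow> ext_measure (borel_of X) \<mu> \<and>
    (\<forall>K. compactin X K \<longrightarrow> (\<exists>e. \<mu> K = Fin e))"

definition regular_borel_ext_measure ::
    "'a topology \<Rightarrow> ('a set \<Rightarrow> 'e::ordered_real_vector ext) \<Rightarrow> bool"
  where "regular_borel_ext_measure X \<mu> \<longleftrightarrow> borel_ext_measure X \<mu> \<and>
    (\<forall>V. openin X V \<longrightarrow> inner_regular_at X \<mu> V) \<and>
    (\<forall>\<Delta>\<in>sets (borel_of X). outer_regular_at X \<mu> \<Delta>)"


section \<open>Spaces of continuous functions\<close>

text \<open>
  A real function on the space \<open>X\<close> is represented by its extension by \<open>0\<close> to the ambient type, so that
  equal functions have equal representatives and the pointwise operations and order are those of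
  the function type.
\<close>

definition cont_functions :: "'a topology \<Rightarrow> ('a \<Rightarrow> real) set"
  where "cont_functions X =
    {f. continuous_map X euclideanreal f \<and> (\<forall>x. x \<notin> topspace X \<longrightarrow> f x = 0)}"

definition supp_in :: "'a topology \<Rightarrow> ('a \<Rightarrow> real) \<Rightarrow> 'a set"
  where "supp_in X f = X closure_of {x \<in> topspace X. f x \<noteq> 0}"

definition Cc :: "'a topology \<Rightarrow> ('a \<Rightarrow> real) set"
  where "Cc X = {f \<in> cont_functions X. compactin X (supp_in X f)}"

definition C0 :: "'a topology \<Rightarrow> ('a \<Rightarrow> real) set"
  where "C0 X = {f \<in> cont_functions X.
    \<forall>\<epsilon>>0. \<exists>K. compactin X K \<and> (\<forall>x\<in>topspace X - K. \<bar>f x\<bar> < \<epsilon>)}"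

text \<open>\<open>fun_below X f S\<close> is \<open>f \<prec> S\<close> and \<open>fun_above X S f\<close> is \<open>S \<prec> f\<close>.\<close>

definition fun_below :: "'a topology \<Rightarrow> ('a \<Rightarrow> real) \<Rightarrow> 'a set \<Rightarrow> bool"
  where "fun_below X f S \<longleftrightarrow>
    f \<in> Cc X \<and> (\<forall>x\<in>topspace X. 0 \<le> f x \<and> f x \<le> 1) \<and> supp_in X f \<subseteq> S"

definition fun_above :: "'a topology \<Rightarrow> 'a set \<Rightarrow> ('a \<Rightarrow> real) \<Rightarrow> bool"
  where "fun_above X S f \<longleftrightarrow>
    f \<in> Cc X \<and> (\<forall>x\<in>topspace X. 0 \<le> f x \<and> f x \<le> 1) \<and> (\<forall>x\<in>S. f x = 1)"

definition positive_operator_C0 ::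
    "'a topology \<Rightarrow> (('a \<Rightarrow> real) \<Rightarrow> 'e::ordered_real_vector) \<Rightarrow> bool"
  where "positive_operator_C0 X \<pi> \<longleftrightarrow>
    (\<forall>f\<in>C0 X. \<forall>g\<in>C0 X. \<pi> (\<lambda>x. f x + g x) = \<pi> f + \<pi> g) \<and>
    (\<forall>c. \<forall>f\<in>C0 X. \<pi> (\<lambda>x. c * f x) = c *\<^sub>R \<pi> f) \<and>
    (\<forall>f\<in>C0 X. (\<forall>x\<in>topspace X. 0 \<le> f x) \<longrightarrow> 0 \<le> \<pi> f)"

definition represents_on ::
    "'a topology \<Rightarrow> ('a set \<Rightarrow> 'e::ordered_real_vector ext) \<Rightarrow> (('a \<Rightarrow> real) \<Rightarrow> 'e) \<Rightarrow>
      ('a \<Rightarrow> real) set \<Rightarrow> bool"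
  where "represents_on X \<mu> \<pi> F \<longleftrightarrow>
    (\<forall>f\<in>F. order_integrable (borel_of X) \<mu> f \<and> \<pi> f = order_integral (borel_of X) \<mu> f)"

end

theory Submission
  imports Defs
begin

text \<open>
  For a positive order continuous functional \<open>x'\<close> on \<open>E\<close>, the functional \<open>x' \<circ> \<pi>\<close> on \<open>C\<^sub>0(X)\<close> is positive,
  hence bounded, and Riesz's construction yields a finite regular Borel measure \<open>m x'\<close>
  representing it.  The Borel sets \<open>\<Delta>\<close> for which some \<open>e \<in> E\<close> satisfies \<open>x'(e) = m x' \<Delta>\<close> for all \<open>x'\<close>
  contain the open sets, because \<open>E\<close> is quasi-perfect, and form a Dynkin system, so all Borel sets
  are among them, and \<open>\<mu>(\<Delta>) = e\<close> is well defined since \<open>E\<close> is normal.  By normality again, every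
  supremum, infimum or order integral in \<open>E\<close> is identified by applying all \<open>x'\<close>, which reduces
  the assertions on \<open>\<mu>\<close> to those on the \<open>m x'\<close>.  For uniqueness, if \<open>\<nu>\<close> represents \<open>\<pi>\<close> and
  \<open>K \<prec> f \<prec> V\<close>, then \<open>\<nu>(K) \<le> \<pi>(f) \<le> \<nu>(V)\<close>, so \<open>\<nu>\<close> agrees with \<open>\<mu>\<close> on open sets and by outer
  regularity everywhere.
\<close>

section \<open>Continuous functions vanishing at infinity\<close>

text \<open>The space E need not be a lattice, so an outer measure with values in E is out of reach:
  infima of families that are not directed may fail to exist. Suprema in E are therefore formed only
  for increasing families, namely the values of \<open>\<pi>\<close> on functions below an open set,
  directed by pointwise maxima, and the partial sums belonging to a disjoint union. Two classes of
  functionals have to be kept apart. Normality and the passage to suprema concern order continuous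
  functionals, while quasi-perfectness asks for boundedness under all positive ones. For open sets
  the latter holds because a positive functional on \<open>C0 X\<close> is automatically bounded on
  functions with values in [0, 1]; this depends on having all of \<open>C0 X\<close>, not only
  \<open>Cc X\<close>, as the domain of \<open>\<pi>\<close>. For unions it holds because the value
  of the whole space is an upper bound in E. A competing measure could take the value
  \<open>Infty\<close> at large sets, so its scalar components are formed only on the compact
  support of one function at a time.\<close>

lemma cont_functions_comp2:
  assumes "f \<in> cont_functions X" "g \<in> cont_functions X"
    and H: "continuous_on UNIV (\<lambda>p::real \<times> real. H (fst p) (snd p))" "H 0 0 = (0::real)"
  shows "(\<lambda>x. H (f x) (g x)) \<in> cont_functions X"
proof -
  have fg: "continuous_map X euclideanreal f" "continuous_map X euclideanreal g"
    using assms by (auto simp: cont_functions_def)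
  have "continuous_map X euclidean (\<lambda>x. (f x, g x))"
    using fg continuous_map_paired[of X euclideanreal euclideanreal f g]
    by (simp add: euclidean_product_topology)
  then have "continuous_map X euclideanreal ((\<lambda>p. H (fst p) (snd p)) \<circ> (\<lambda>x. (f x, g x)))"
    using H(1) by (intro continuous_map_compose[where X' = euclidean]) auto
  then show ?thesis
    using assms by (auto simp: cont_functions_def o_def)
qed

lemma closedin_superlevel:
  assumes "f \<in> cont_functions X"
  shows "closedin X {x \<in> topspace X. c \<le> f x}"
proof -
  have "closedin X {x \<in> topspace X. f x \<in> {c..}}"
    using assms by (intro closedin_continuous_map_preimage[where Y = euclideanreal])
      (auto simp: cont_functions_def)
  then show ?thesis by simp
qed

lemma openin_superlevel:
  assumes "f \<in> cont_functions X"
  shows "openin X {x \<in> topspace X. c < f x}"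
proof -
  have "openin X {x \<in> topspace X. f x \<in> {c<..}}"
    using assms by (intro openin_continuous_map_preimage[where Y = euclideanreal])
      (auto simp: cont_functions_def)
  then show ?thesis by simp
qed

lemma C0_small_outside_compact:
  assumes "f \<in> C0 X" "e > 0"
  obtains K where "compactin X K" "\<And>x. x \<in> topspace X - K \<Longrightarrow> \<bar>f x\<bar> < e"
proof -
  from assms have "\<exists>K. compactin X K \<and> (\<forall>x\<in>topspace X - K. \<bar>f x\<bar> < e)"
    by (simp add: C0_def)
  then show ?thesis using that by blast
qed

text \<open>Continuity of \<open>H\<close> at the origin gives a radius, and off the union of two
  compact sets the pair of arguments stays within it. One binary statement covers sums, differences,
  products and compositions.\<close>

lemma C0_comp2:
  assumes f: "f \<in> C0 X" and g: "g \<in> C0 X"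
    and H: "continuous_on UNIV (\<lambda>p::real \<times> real. H (fst p) (snd p))" "H 0 0 = (0::real)"
  shows "(\<lambda>x. H (f x) (g x)) \<in> C0 X"
proof -
  have "\<exists>K. compactin X K \<and> (\<forall>x\<in>topspace X - K. \<bar>H (f x) (g x)\<bar> < e)" if "e > 0" for e
  proof -
    obtain d where d: "d > 0" "\<And>p. dist p (0, 0) < d \<Longrightarrow> dist (H (fst p) (snd p)) (H 0 0) < e"
      using H(1) \<open>e > 0\<close> unfolding continuous_on_iff
      by (metis UNIV_I fst_conv snd_conv)
    from d(1) have "d / 2 > 0" by simp
    with f g obtain K1 K2 where K: "compactin X K1" "\<And>x. x \<in> topspace X - K1 \<Longrightarrow> \<bar>f x\<bar> < d / 2"
      "compactin X K2" "\<And>x. x \<in> topspace X - K2 \<Longrightarrow> \<bar>g x\<bar> < d / 2"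
      using C0_small_outside_compact by metis
    have "\<bar>H (f x) (g x)\<bar> < e" if "x \<in> topspace X - (K1 \<union> K2)" for x
    proof -
      have "\<bar>f x\<bar> < d / 2" "\<bar>g x\<bar> < d / 2"
        using K that by auto
      moreover have "dist (f x, g x) (0, 0) \<le> \<bar>f x\<bar> + \<bar>g x\<bar>"
        by (simp add: dist_Pair_Pair sqrt_sum_squares_le_sum_abs)
      ultimately have "dist (f x, g x) (0, 0) < d" by linarith
      from d(2)[OF this] show ?thesis using H(2) by simp
    qed
    with compactin_Un[OF K(1,3)] show ?thesis by blast
  qed
  then show ?thesis
    using cont_functions_comp2[OF _ _ H] f g unfolding C0_def by blast
qed

lemma C0_add: "f \<in> C0 X \<Longrightarrow> g \<in> C0 X \<Longrightarrow> (\<lambda>x. f x + g x) \<in> C0 X"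
  by (rule C0_comp2[where H = "\<lambda>a b. a + b"]) (auto intro!: continuous_intros)

lemma C0_diff: "f \<in> C0 X \<Longrightarrow> g \<in> C0 X \<Longrightarrow> (\<lambda>x. f x - g x) \<in> C0 X"
  by (rule C0_comp2[where H = "\<lambda>a b. a - b"]) (auto intro!: continuous_intros)

lemma C0_mult: "f \<in> C0 X \<Longrightarrow> g \<in> C0 X \<Longrightarrow> (\<lambda>x. f x * g x) \<in> C0 X"
  by (rule C0_comp2[where H = "\<lambda>a b. a * b"]) (auto intro!: continuous_intros)

lemma C0_comp:
  assumes "f \<in> C0 X" "continuous_on UNIV h" "h 0 = (0::real)"
  shows "(\<lambda>x. h (f x)) \<in> C0 X"
proof (rule C0_comp2[where H = "\<lambda>a b. h a", OF assms(1,1)])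
  show "continuous_on UNIV (\<lambda>p::real \<times> real. h (fst p))"
    by (rule continuous_on_compose2[OF assms(2)]) (auto intro!: continuous_intros)
qed (fact assms(3))

lemma C0_cmult: "f \<in> C0 X \<Longrightarrow> (\<lambda>x. c * f x) \<in> C0 X"
  by (rule C0_comp[where h = "\<lambda>a. c * a"]) (auto intro!: continuous_intros)

lemma C0_abs: "f \<in> C0 X \<Longrightarrow> (\<lambda>x. \<bar>f x\<bar>) \<in> C0 X"
  by (rule C0_comp[where h = "\<lambda>a. \<bar>a\<bar>"]) (auto intro!: continuous_intros)

lemma C0_zero: "(\<lambda>x. 0) \<in> C0 X"
  by (auto simp: C0_def cont_functions_def intro!: exI[of _ "{}"])

lemma C0_sum: "(\<And>i. i \<in> I \<Longrightarrow> f i \<in> C0 X) \<Longrightarrow> (\<lambda>x. \<Sum>i\<in>I. f i x) \<in> C0 X"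
  by (induction I rule: infinite_finite_induct) (auto intro: C0_zero C0_add)

lemma C0_outside: "f \<in> C0 X \<Longrightarrow> x \<notin> topspace X \<Longrightarrow> f x = 0"
  by (simp add: C0_def cont_functions_def)

lemma C0_bounded:
  assumes "f \<in> C0 X"
  obtains B where "B > 0" "\<And>x. \<bar>f x\<bar> \<le> B"
proof -
  obtain K where K: "compactin X K" "\<And>x. x \<in> topspace X - K \<Longrightarrow> \<bar>f x\<bar> < 1"
    using C0_small_outside_compact[OF assms zero_less_one] by blast
  have "compactin euclideanreal (f ` K)"
    using assms K(1) by (intro image_compactin) (auto simp: C0_def cont_functions_def)
  then obtain b where b: "b > 0" "\<And>y. y \<in> f ` K \<Longrightarrow> \<bar>y\<bar> \<le> b"
    using compact_imp_bounded[of "f ` K"] unfolding bounded_pos by auto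
  have "\<bar>f x\<bar> \<le> b + 1" for x
    using b K(2)[of x] C0_outside[OF assms, of x] by (cases "x \<in> K"; cases "x \<in> topspace X") force+
  with b(1) show ?thesis by (intro that[of "b + 1"]) auto
qed

text \<open>Completeness of the space: it makes the series in the proof of
  \<open>bounded_on_unit\<close> an element to which the functional can be applied.\<close>

lemma C0_uniform_limit:
  assumes g: "\<And>n. g n \<in> C0 X" and lim: "uniform_limit UNIV g F sequentially"
  shows "F \<in> C0 X"
proof -
  have "continuous_map X Met_TC.mtopology F"
  proof (rule Met_TC.continuous_map_uniform_limit)
    show "\<forall>\<^sub>F n in sequentially. continuous_map X Met_TC.mtopology (g n)"
      using g by (auto simp: C0_def cont_functions_def)
    show "\<forall>\<^sub>F n in sequentially. \<forall>x\<in>topspace X. F x \<in> UNIV \<and> dist (g n x) (F x) < e" if "e > 0" for e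
      using uniform_limitD[OF lim that] by (rule eventually_mono) auto
  qed simp
  moreover have "F x = 0" if "x \<notin> topspace X" for x
  proof (rule LIMSEQ_unique)
    show "(\<lambda>n. g n x) \<longlonglongrightarrow> F x"
      using tendsto_uniform_limitI[OF lim] by simp
    show "(\<lambda>n. g n x) \<longlonglongrightarrow> 0"
      using C0_outside[OF g that] by simp
  qed
  moreover have "\<exists>K. compactin X K \<and> (\<forall>x\<in>topspace X - K. \<bar>F x\<bar> < e)" if e: "e > 0" for e
  proof -
    have "\<forall>\<^sub>F n in sequentially. \<forall>x\<in>UNIV. dist (g n x) (F x) < e / 2"
      using uniform_limitD[OF lim, of "e / 2"] e by simp
    then obtain n where n: "\<And>x. dist (g n x) (F x) < e / 2"
      by (auto simp: eventually_sequentially)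
    obtain K where "compactin X K" "\<And>x. x \<in> topspace X - K \<Longrightarrow> \<bar>g n x\<bar> < e / 2"
      using C0_small_outside_compact[OF g half_gt_zero[OF e]] by blast
    moreover have "\<bar>F x\<bar> < e" if "\<bar>g n x\<bar> < e / 2" for x
      using n[of x] that unfolding dist_real_def by linarith
    ultimately show ?thesis by blast
  qed
  ultimately show ?thesis
    by (simp add: C0_def cont_functions_def)
qed

section \<open>Compactly supported functions and Urysohn's lemma\<close>

lemma supp_in_zero: "x \<notin> supp_in X f \<Longrightarrow> f \<in> cont_functions X \<Longrightarrow> f x = 0"
  unfolding supp_in_def cont_functions_def
  by (metis (mono_tags, lifting) closure_of_subset mem_Collect_eq subset_eq)

lemma supp_in_minimal:
  assumes "closedin X C" "\<And>x. x \<notin> C \<Longrightarrow> f x = 0"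
  shows "supp_in X f \<subseteq> C"
  unfolding supp_in_def using assms by (intro closure_of_minimal) auto

lemma closedin_supp_in: "closedin X (supp_in X f)"
  by (simp add: supp_in_def)

lemma CcI:
  assumes "f \<in> cont_functions X" "compactin X K" "closedin X C" "C \<subseteq> K" "\<And>x. x \<notin> C \<Longrightarrow> f x = 0"
  shows "f \<in> Cc X" "supp_in X f \<subseteq> C"
proof -
  show "supp_in X f \<subseteq> C"
    using assms by (intro supp_in_minimal) auto
  with assms(4) have "compactin X (supp_in X f)"
    by (intro closed_compactin[OF assms(2) _ closedin_supp_in]) auto
  with assms(1) show "f \<in> Cc X"
    by (simp add: Cc_def)
qed

lemma Cc_subset_C0: "Cc X \<subseteq> C0 X"
proof
  fix f assume f: "f \<in> Cc X"
  then have "f \<in> cont_functions X" "compactin X (supp_in X f)"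
    by (auto simp: Cc_def)
  then show "f \<in> C0 X"
    using supp_in_zero[of _ X f] unfolding C0_def by (auto intro!: exI[of _ "supp_in X f"])
qed

lemma Cc_comp2:
  assumes f: "f \<in> Cc X" and g: "g \<in> Cc X"
    and H: "continuous_on UNIV (\<lambda>p::real \<times> real. H (fst p) (snd p))" "H 0 0 = (0::real)"
  shows "(\<lambda>x. H (f x) (g x)) \<in> Cc X" "supp_in X (\<lambda>x. H (f x) (g x)) \<subseteq> supp_in X f \<union> supp_in X g"
proof -
  have fg: "f \<in> cont_functions X" "g \<in> cont_functions X"
    using f g by (auto simp: Cc_def)
  have *: "compactin X (supp_in X f \<union> supp_in X g)" "closedin X (supp_in X f \<union> supp_in X g)"
    using f g closedin_supp_in[of X f] closedin_supp_in[of X g]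
    by (auto simp: Cc_def compactin_Un)
  have "H (f x) (g x) = 0" if "x \<notin> supp_in X f \<union> supp_in X g" for x
    using that supp_in_zero[OF _ fg(1)] supp_in_zero[OF _ fg(2)] H(2) by auto
  from CcI[OF cont_functions_comp2[OF fg H] * order_refl this]
  show "(\<lambda>x. H (f x) (g x)) \<in> Cc X" "supp_in X (\<lambda>x. H (f x) (g x)) \<subseteq> supp_in X f \<union> supp_in X g"
    by blast+
qed

text \<open>Cutting at height \<open>e\<close> replaces the closure of the set where
  \<open>f\<close> is nonzero, which may be too large, by the closed set where \<open>f\<close> is
  at least \<open>e\<close>, and this set lies in \<open>K\<close>. Smallness off a single compact
  set suffices, so functions not known to lie in \<open>C0 X\<close> are covered.\<close>

lemma truncation:
  assumes f: "f \<in> cont_functions X" and e: "e > 0"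
    and K: "compactin X K" "\<And>x. x \<in> topspace X - K \<Longrightarrow> f x < e"
  shows "(\<lambda>x. max 0 (f x - e)) \<in> Cc X"
    and "supp_in X (\<lambda>x. max 0 (f x - e)) \<subseteq> {x \<in> topspace X. e \<le> f x}"
proof -
  have "(\<lambda>x. (\<lambda>a b. max 0 (a - e)) (f x) (f x)) \<in> cont_functions X"
    using e by (intro cont_functions_comp2[OF f f]) (auto intro!: continuous_intros)
  then have c: "(\<lambda>x. max 0 (f x - e)) \<in> cont_functions X" by simp
  have sub: "{x \<in> topspace X. e \<le> f x} \<subseteq> K"
    using K(2) by force
  have z: "max 0 (f x - e) = 0" if "x \<notin> {x \<in> topspace X. e \<le> f x}" for x
    using that f e by (cases "x \<in> topspace X") (auto simp: cont_functions_def)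
  show "(\<lambda>x. max 0 (f x - e)) \<in> Cc X"
    and "supp_in X (\<lambda>x. max 0 (f x - e)) \<subseteq> {x \<in> topspace X. e \<le> f x}"
    using CcI[OF c K(1) closedin_superlevel[OF f] sub z] by blast+
qed

lemma Urysohn_Cc:
  assumes X: "locally_compact_space X" "Hausdorff_space X"
    and K: "compactin X K" and V: "openin X V" "K \<subseteq> V"
  obtains f where "fun_above X K f" "fun_below X f V"
proof -
  obtain U L where UL: "openin X U" "compactin X L" "K \<subseteq> U" "U \<subseteq> L"
    using locally_compact_space_compact_closed_compact[of X] X K by meson
  have cr: "completely_regular_space X"
    using X by (intro locally_compact_regular_imp_completely_regular_space) auto
  have "closedin X (topspace X - U \<inter> V)"
    using UL V by (intro openin_closedin_eq[THEN iffD1, THEN conjunct2] openin_Int) auto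
  moreover have "disjnt (topspace X - U \<inter> V) K"
    using UL V by (auto simp: disjnt_def)
  ultimately obtain h where h: "continuous_map X (top_of_set {0..1}) h"
    "h ` K \<subseteq> {1}" "h ` (topspace X - U \<inter> V) \<subseteq> {0::real}"
    using Urysohn_completely_regular_compact_closed[of 0 1, OF _ cr K] by (metis disjnt_sym zero_le_one)
  have h01: "\<And>x. x \<in> topspace X \<Longrightarrow> 0 \<le> h x \<and> h x \<le> 1"
    using h(1) by (auto simp: continuous_map_in_subtopology)
  \<comment> \<open>\<open>h\<close> vanishes off \<open>U \<inter> V\<close>, but its support may
    leave that set. Doubling and then subtracting 1 keeps the value 1 on \<open>K\<close> and moves
    the support into the closed set where \<open>h\<close> is at least 1/2, which lies in
    \<open>V\<close> and in the compact \<open>L\<close>.\<close>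
  define f where "f x = (if x \<in> topspace X then 2 * h x else 0)" for x
  have "continuous_map X euclideanreal (\<lambda>x. 2 * h x)"
    using h(1) by (intro continuous_intros) (auto simp: continuous_map_in_subtopology)
  then have f: "f \<in> cont_functions X"
    by (auto simp: cont_functions_def f_def intro: continuous_map_eq)
  have off: "f x = 0" if "x \<notin> U \<inter> V" for x
    using h(3) that by (auto simp: f_def)
  have K1: "f x < 1" if "x \<in> topspace X - L" for x
  proof -
    have "x \<notin> U \<inter> V" using UL(4) that by blast
    with off show ?thesis by simp
  qed
  define g where "g x = max 0 (f x - 1)" for x
  note t = truncation[OF f zero_less_one UL(2) K1]
  have g: "g \<in> Cc X" "supp_in X g \<subseteq> {x \<in> topspace X. 1 \<le> f x}"
    using t unfolding g_def[abs_def] by auto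
  have "{x \<in> topspace X. 1 \<le> f x} \<subseteq> V"
    using off by force
  moreover have "\<forall>x\<in>topspace X. 0 \<le> g x \<and> g x \<le> 1"
    using h01 by (auto simp: g_def f_def)
  moreover have "\<forall>x\<in>K. g x = 1"
    using h(2) compactin_subset_topspace[OF K] by (force simp: g_def f_def)
  ultimately show ?thesis
    using g by (intro that[of g]) (auto simp: fun_above_def fun_below_def)
qed

section \<open>Functions below open sets and above compact sets\<close>

lemma fun_below_C0: "fun_below X f V \<Longrightarrow> f \<in> C0 X"
  using Cc_subset_C0 by (auto simp: fun_below_def)

lemma fun_below_bounds:
  assumes "fun_below X f V"
  shows "0 \<le> f x" "f x \<le> 1" "x \<notin> V \<Longrightarrow> f x = 0"
proof -
  have f: "f \<in> cont_functions X"
    using assms by (auto simp: fun_below_def Cc_def)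
  show "x \<notin> V \<Longrightarrow> f x = 0"
    using assms supp_in_zero[OF _ f] by (auto simp: fun_below_def)
  have "0 \<le> f x \<and> f x \<le> 1"
  proof (cases "x \<in> topspace X")
    case True
    with assms show ?thesis by (simp add: fun_below_def)
  next
    case False
    with C0_outside[OF fun_below_C0[OF assms]] show ?thesis by simp
  qed
  then show "0 \<le> f x" "f x \<le> 1" by auto
qed

lemma fun_below_mono: "fun_below X f V \<Longrightarrow> V \<subseteq> W \<Longrightarrow> fun_below X f W"
  by (auto simp: fun_below_def)

lemma fun_below_zero: "fun_below X (\<lambda>x. 0) V"
  by (auto simp: fun_below_def Cc_def cont_functions_def supp_in_def)

lemma fun_above_C0: "fun_above X K f \<Longrightarrow> f \<in> C0 X"
  using Cc_subset_C0 by (auto simp: fun_above_def)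

lemma fun_above_bounds:
  assumes "fun_above X K f"
  shows "0 \<le> f x" "f x \<le> 1" "x \<in> K \<Longrightarrow> f x = 1"
proof -
  have "0 \<le> f x \<and> f x \<le> 1"
  proof (cases "x \<in> topspace X")
    case True
    with assms show ?thesis by (simp add: fun_above_def)
  next
    case False
    with C0_outside[OF fun_above_C0[OF assms]] show ?thesis by simp
  qed
  then show "0 \<le> f x" "f x \<le> 1" by auto
  show "x \<in> K \<Longrightarrow> f x = 1"
    using assms by (simp add: fun_above_def)
qed

section \<open>The Riesz representation theorem for real functionals\<close>

text \<open>Cuts the height \<open>t\<close> into unit layers. Applied to N f(x), it writes N f as a
  sum of continuous functions, each pinned between the indicators of two consecutive superlevel sets
  of \<open>f\<close>.\<close>

lemma sum_clamp: "t \<ge> 0 \<Longrightarrow> (\<Sum>i<n. min (max (t - real i) 0) 1) = min t (real n)"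
  by (induction n) auto

lemma space_borel_of [simp]: "space (borel_of X) = topspace X"
  unfolding borel_of_def by (rule space_measure_of) (auto dest: openin_subset)

lemma sets_borel_of: "sets (borel_of X) = sigma_sets (topspace X) {U. openin X U}"
  unfolding borel_of_def by (rule sets_measure_of) (auto dest: openin_subset)

lemma open_in_sets_borel_of: "openin X U \<Longrightarrow> U \<in> sets (borel_of X)"
  by (auto simp: sets_borel_of)

lemma closed_in_sets_borel_of: "closedin X C \<Longrightarrow> C \<in> sets (borel_of X)"
  using sets.compl_sets[OF open_in_sets_borel_of[of X "topspace X - C"]]
  by (metis Diff_Diff_Int Int_absorb1 closedin_def space_borel_of)

lemma cont_functions_measurable:
  assumes "f \<in> cont_functions X"
  shows "f \<in> borel_measurable (borel_of X)"
proof (rule borel_measurableI)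
  fix S :: "real set" assume "open S"
  with assms have "openin X {x \<in> topspace X. f x \<in> S}"
    by (intro openin_continuous_map_preimage[where Y = euclideanreal]) (auto simp: cont_functions_def)
  moreover have "{x \<in> topspace X. f x \<in> S} = f -` S \<inter> space (borel_of X)"
    by auto
  ultimately show "f -` S \<inter> space (borel_of X) \<in> sets (borel_of X)"
    using open_in_sets_borel_of by metis
qed

text \<open>The second function lives off the support of the first, so at each point at most one
  summand is nonzero and the bound 1 survives.\<close>

lemma fun_below_add:
  assumes "fun_below X f U" "fun_below X g (U - supp_in X f)"
  shows "fun_below X (\<lambda>x. f x + g x) U"
proof -
  have Cc: "f \<in> Cc X" "g \<in> Cc X"
    using assms by (auto simp: fun_below_def)
  note * = Cc_comp2[OF Cc, of "\<lambda>a b. a + b"]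
  have "f x + g x \<le> 1" for x
  proof (cases "x \<in> supp_in X f")
    case True
    then show ?thesis
      using fun_below_bounds[OF assms(1), of x] fun_below_bounds(3)[OF assms(2), of x] by simp
  next
    case False
    then have "f x = 0"
      using supp_in_zero Cc by (auto simp: Cc_def)
    then show ?thesis
      using fun_below_bounds[OF assms(2), of x] by simp
  qed
  moreover have "0 \<le> f x + g x" for x
    using fun_below_bounds(1)[OF assms(1)] fun_below_bounds(1)[OF assms(2)] by simp
  moreover have "(\<lambda>x. f x + g x) \<in> Cc X" "supp_in X (\<lambda>x. f x + g x) \<subseteq> supp_in X f \<union> supp_in X g"
    by (rule *; auto intro!: continuous_intros)+
  ultimately show ?thesis
    using assms by (auto simp: fun_below_def)
qed

lemma fun_below_max:
  assumes "fun_below X f U" "fun_below X g U"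
  shows "fun_below X (\<lambda>x. max (f x) (g x)) U"
proof -
  have Cc: "f \<in> Cc X" "g \<in> Cc X"
    using assms by (auto simp: fun_below_def)
  note * = Cc_comp2[OF Cc, of "\<lambda>a b. max a b"]
  have "(\<lambda>x. max (f x) (g x)) \<in> Cc X" "supp_in X (\<lambda>x. max (f x) (g x)) \<subseteq> supp_in X f \<union> supp_in X g"
    by (rule *; auto intro!: continuous_intros)+
  then show ?thesis
    using assms by (auto simp: fun_below_def le_max_iff_disj)
qed

section \<open>Positive functionals and their automatic boundedness\<close>

locale C0_functional =
  fixes X :: "'a topology" and \<Lambda> :: "('a \<Rightarrow> real) \<Rightarrow> real"
  assumes lc: "locally_compact_space X" and Hd: "Hausdorff_space X"
    and add: "\<And>f g. f \<in> C0 X \<Longrightarrow> g \<in> C0 X \<Longrightarrow> \<Lambda> (\<lambda>x. f x + g x) = \<Lambda> f + \<Lambda> g"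
    and scale: "\<And>c f. f \<in> C0 X \<Longrightarrow> \<Lambda> (\<lambda>x. c * f x) = c * \<Lambda> f"
    and nonneg: "\<And>f. f \<in> C0 X \<Longrightarrow> (\<And>x. 0 \<le> f x) \<Longrightarrow> 0 \<le> \<Lambda> f"
begin

lemma diff: "f \<in> C0 X \<Longrightarrow> g \<in> C0 X \<Longrightarrow> \<Lambda> (\<lambda>x. f x - g x) = \<Lambda> f - \<Lambda> g"
  using add[of "\<lambda>x. f x - g x" g] C0_diff[of f X g] by simp

lemma mono: "f \<in> C0 X \<Longrightarrow> g \<in> C0 X \<Longrightarrow> (\<And>x. f x \<le> g x) \<Longrightarrow> \<Lambda> f \<le> \<Lambda> g"
  using nonneg[OF C0_diff[of g X f]] diff[of g f] by simp

lemma zero: "\<Lambda> (\<lambda>x. 0) = 0"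
  using diff[OF C0_zero C0_zero] by simp

lemma sum:
  "finite I \<Longrightarrow> (\<And>i. i \<in> I \<Longrightarrow> f i \<in> C0 X) \<Longrightarrow> \<Lambda> (\<lambda>x. \<Sum>i\<in>I. f i x) = (\<Sum>i\<in>I. \<Lambda> (f i))"
  by (induction I rule: finite_induct) (auto simp: zero add C0_sum)

text \<open>Otherwise some \<open>f\<^sub>n\<close> with \<open>0 \<le> f\<^sub>n \<le> 1\<close> satisfy \<open>\<Lambda> f\<^sub>n > 2\<^sup>n\<close>, and \<open>\<Lambda>\<close> has no value at
  \<open>\<Sum>\<^sub>n 2\<^sup>-\<^sup>n f\<^sub>n \<in> C\<^sub>0(X)\<close>.\<close>

lemma bounded_on_unit:
  obtains B where "\<And>f. f \<in> C0 X \<Longrightarrow> (\<And>x. 0 \<le> f x) \<Longrightarrow> (\<And>x. f x \<le> 1) \<Longrightarrow> \<Lambda> f \<le> B"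
proof (rule ccontr)
  assume no: "\<not> thesis"
  have "\<exists>f. f \<in> C0 X \<and> (\<forall>x. 0 \<le> f x \<and> f x \<le> 1) \<and> 2 ^ n < \<Lambda> f" for n :: nat
    using no that[of "2 ^ n"] by (meson not_le)
  then obtain f where f: "\<And>n. f n \<in> C0 X" "\<And>n x. 0 \<le> f n x" "\<And>n x. f n x \<le> 1"
    "\<And>n::nat. 2 ^ n < \<Lambda> (f n)"
    by metis
  define g where "g n x = (1 / 2) ^ n * f n x" for n x
  have g: "g n \<in> C0 X" "\<And>x. 0 \<le> g n x" "\<And>x. g n x \<le> (1 / 2) ^ n" for n
    using C0_cmult[OF f(1)] f(2,3) by (auto simp: g_def[abs_def] mult_left_le)
  have "1 < \<Lambda> (g n)" for n
  proof -
    have "\<Lambda> (g n) = (1 / 2) ^ n * \<Lambda> (f n)"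
      unfolding g_def[abs_def] by (rule scale[OF f(1)])
    moreover have "(1 / 2) ^ n * 2 ^ n < (1 / 2) ^ n * \<Lambda> (f n)"
      using f(4)[of n] by (intro mult_strict_left_mono) auto
    ultimately show ?thesis by (simp flip: power_mult_distrib)
  qed
  then have big: "real N \<le> (\<Sum>n<N. \<Lambda> (g n))" for N
    using sum_mono[of "{..<N}" "\<lambda>n. 1" "\<lambda>n. \<Lambda> (g n)"] by (force simp: less_imp_le)
  define F where "F x = (\<Sum>n. g n x)" for x
  have "summable (\<lambda>n. (1 / 2 :: real) ^ n)" by simp
  then have "uniform_limit UNIV (\<lambda>N x. \<Sum>n<N. g n x) F sequentially"
    unfolding F_def[abs_def] using g(2,3) by (intro Weierstrass_m_test) auto
  then have F: "F \<in> C0 X"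
    by (rule C0_uniform_limit[rotated]) (auto intro: C0_sum g(1))
  have sm: "summable (\<lambda>n. g n x)" for x
    using g(2,3) by (intro summable_comparison_test'[OF \<open>summable (\<lambda>n. (1 / 2 :: real) ^ n)\<close>, where N = 0]) auto
  have "real N \<le> \<Lambda> F" for N
  proof -
    have "(\<Sum>n<N. \<Lambda> (g n)) = \<Lambda> (\<lambda>x. \<Sum>n<N. g n x)"
      using g(1) by (simp add: sum)
    also have "\<dots> \<le> \<Lambda> F"
      using F g(1,2) sm by (intro mono C0_sum) (auto simp: F_def intro!: sum_le_suminf)
    finally show ?thesis using big[of N] by simp
  qed
  then show False
    using reals_Archimedean2[of "\<Lambda> F"] by (metis not_le)
qed

section \<open>The set function of Riesz's construction\<close>

definition om :: "'a set \<Rightarrow> real"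
  where "om V = Sup {\<Lambda> f |f. fun_below X f V}"

text \<open>Together with \<open>fun_below_zero\<close> this makes \<open>Sup\<close> a genuine
  supremum. It also verifies, for every positive functional on E, the boundedness condition in
  \<open>quasi_perfect\<close>.\<close>

lemma om_bdd: "bdd_above {\<Lambda> f |f. fun_below X f V}"
proof -
  obtain B where "\<And>f. f \<in> C0 X \<Longrightarrow> (\<And>x. 0 \<le> f x) \<Longrightarrow> (\<And>x. f x \<le> 1) \<Longrightarrow> \<Lambda> f \<le> B"
    using bounded_on_unit by blast
  then show ?thesis
    using fun_below_C0[of X _ V] fun_below_bounds(1,2)[of X _ V] by (intro bdd_aboveI[of _ B]) auto
qed

lemma om_upper: "fun_below X f V \<Longrightarrow> \<Lambda> f \<le> om V"
  unfolding om_def using om_bdd by (intro cSup_upper) auto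

lemma om_least: "(\<And>f. fun_below X f V \<Longrightarrow> \<Lambda> f \<le> c) \<Longrightarrow> om V \<le> c"
  unfolding om_def using fun_below_zero by (intro cSup_least) auto

lemma om_approx:
  assumes "e > 0"
  obtains f where "fun_below X f V" "om V - e < \<Lambda> f"
proof -
  have "\<exists>f. fun_below X f V \<and> om V - e < \<Lambda> f"
  proof (rule ccontr)
    assume "\<nexists>f. fun_below X f V \<and> om V - e < \<Lambda> f"
    then have "om V \<le> om V - e"
      by (intro om_least) (auto simp: not_less)
    with assms show False by simp
  qed
  with that show ?thesis by blast
qed

lemma om_nonneg: "0 \<le> om V"
  using om_upper[OF fun_below_zero] zero by simp

lemma om_mono: "V \<subseteq> W \<Longrightarrow> om V \<le> om W"
  by (rule om_least) (erule om_upper[OF fun_below_mono])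

lemma om_le_topspace: "om V \<le> om (topspace X)"
proof (rule om_least)
  fix f assume f: "fun_below X f V"
  have "supp_in X f \<subseteq> topspace X"
    by (rule closedin_subset[OF closedin_supp_in])
  with f have "fun_below X f (topspace X)"
    by (simp add: fun_below_def)
  then show "\<Lambda> f \<le> om (topspace X)" by (rule om_upper)
qed

lemma om_empty: "om {} = 0"
proof (rule antisym[OF om_least om_nonneg])
  fix f assume f: "fun_below X f {}"
  have "f = (\<lambda>x. 0)"
    using fun_below_bounds(3)[OF f] by auto
  then show "\<Lambda> f \<le> 0" by (simp add: zero)
qed

text \<open>\<open>f - min f \<epsilon>\<close> has its support in \<open>V\<close>, and \<open>min f \<epsilon> = \<epsilon> (min f \<epsilon> / \<epsilon>)\<close> is negligible since
  \<open>\<Lambda>\<close> is bounded.\<close>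

lemma le_om:
  assumes f: "f \<in> C0 X" "\<And>x. 0 \<le> f x" "\<And>x. f x \<le> 1" "\<And>x. x \<notin> V \<Longrightarrow> f x = 0"
  shows "\<Lambda> f \<le> om V"
proof -
  obtain B where B: "\<And>f. f \<in> C0 X \<Longrightarrow> (\<And>x. 0 \<le> f x) \<Longrightarrow> (\<And>x. f x \<le> 1) \<Longrightarrow> \<Lambda> f \<le> B"
    using bounded_on_unit by blast
  have B0: "0 \<le> B"
    using B[OF C0_zero] zero by simp
  have "\<Lambda> f \<le> om V + e" if e: "e > 0" for e
  proof -
    define d where "d = e / (B + 1)"
    have d: "d > 0" "d * B \<le> e"
      using e B0 by (auto simp: d_def field_simps)
    define g where "g x = max 0 (f x - d)" for x
    define h where "h x = min (f x / d) 1" for x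
    have h: "h \<in> C0 X"
      using C0_comp[OF f(1), of "\<lambda>a. min (a / d) 1"] d
      by (simp add: h_def[abs_def] continuous_intros)
    obtain K where K: "compactin X K" "\<And>x. x \<in> topspace X - K \<Longrightarrow> \<bar>f x\<bar> < d"
      using C0_small_outside_compact[OF f(1) d(1)] by blast
    have fc: "f \<in> cont_functions X"
      using f(1) by (simp add: C0_def)
    have fK: "f x < d" if "x \<in> topspace X - K" for x
      using K(2)[OF that] by simp
    have "g \<in> Cc X" "supp_in X g \<subseteq> {x \<in> topspace X. d \<le> f x}"
      using truncation[OF fc d(1) K(1) fK] by (auto simp: g_def[abs_def])
    moreover have "{x \<in> topspace X. d \<le> f x} \<subseteq> V"
      using f(4) d(1) by force
    moreover have "0 \<le> g x" "g x \<le> 1" for x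
      using f(2)[of x] f(3)[of x] d(1) by (auto simp: g_def)
    ultimately have g: "fun_below X g V"
      by (auto simp: fun_below_def)
    have "f x = g x + d * h x" for x
      using d(1) by (auto simp: g_def h_def min_def max_def field_simps)
    then have "f = (\<lambda>x. g x + d * h x)" by auto
    then have "\<Lambda> f = \<Lambda> g + d * \<Lambda> h"
      using add[OF fun_below_C0[OF g] C0_cmult[OF h, of d]] scale[OF h, of d] by simp
    also have "\<dots> \<le> om V + d * B"
      using om_upper[OF g] d(1) f(2) by (intro add_mono mult_left_mono B h) (auto simp: h_def)
    finally show ?thesis using d(2) by simp
  qed
  then show ?thesis
    by (rule field_le_epsilon)
qed

lemma om_le:
  assumes "f \<in> C0 X" "\<And>x. 0 \<le> f x" "\<And>x. x \<in> V \<Longrightarrow> 1 \<le> f x"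
  shows "om V \<le> \<Lambda> f"
proof (rule om_least)
  fix g assume g: "fun_below X g V"
  show "\<Lambda> g \<le> \<Lambda> f"
  proof (rule mono)
    fix x
    show "g x \<le> f x"
      using fun_below_bounds[OF g, of x] assms(2,3)[of x] by (cases "x \<in> V") auto
  qed (use g assms fun_below_C0 in auto)
qed

text \<open>One Urysohn function replaces a partition of unity: \<open>h\<close> is 1 on
  \<open>K - W\<close> and supported in \<open>V\<close>, and \<open>f\<close> splits into f h and f
  (1 - h). The second summand vanishes off \<open>W\<close>, but its support may leave
  \<open>W\<close>; hence \<open>le_om\<close> is used and not \<open>om_upper\<close>.\<close>

lemma om_Un:
  assumes V: "openin X V" "openin X W"
  shows "om (V \<union> W) \<le> om V + om W"
proof (rule om_least)
  fix f assume f: "fun_below X f (V \<union> W)"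
  define K where "K = supp_in X f"
  have K: "compactin X K" "K \<subseteq> V \<union> W"
    using f by (auto simp: K_def fun_below_def Cc_def)
  have "compactin X (K - W)"
    using K V(2) compactin_subset_topspace[OF K(1)]
    by (intro closed_compactin[OF K(1)]) (auto simp: K_def closedin_supp_in closedin_diff)
  moreover have "K - W \<subseteq> V" using K by auto
  ultimately obtain h where h: "fun_above X (K - W) h" "fun_below X h V"
    using Urysohn_Cc[OF lc Hd _ V(1)] by blast
  have hb: "0 \<le> h x" "h x \<le> 1" "0 \<le> f x" "f x \<le> 1" for x
    using fun_below_bounds[OF h(2)] fun_below_bounds[OF f] by auto
  have C: "f \<in> C0 X" "h \<in> C0 X"
    using f h fun_below_C0 by auto
  have fh: "(\<lambda>x. f x * h x) \<in> C0 X" "(\<lambda>x. f x - f x * h x) \<in> C0 X"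
    using C0_mult[OF C] C0_diff[OF C(1) C0_mult[OF C]] by auto
  have "\<Lambda> f = \<Lambda> (\<lambda>x. f x * h x) + \<Lambda> (\<lambda>x. f x - f x * h x)"
    using add[OF fh] by simp
  also have "\<dots> \<le> om V + om W"
  proof (intro add_mono le_om fh)
    fix x
    show "0 \<le> f x * h x" "f x * h x \<le> 1" using hb by (auto intro: mult_le_one)
    show "0 \<le> f x - f x * h x" using hb[of x] by (simp add: mult_left_le)
    show "f x - f x * h x \<le> 1" using hb[of x] by (smt (verit) mult_nonneg_nonneg)
    show "f x * h x = 0" if "x \<notin> V" using fun_below_bounds(3)[OF h(2) that] by simp
    show "f x - f x * h x = 0" if "x \<notin> W"
    proof (cases "x \<in> K")
      case True
      with that fun_above_bounds(3)[OF h(1), of x] show ?thesis by simp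
    next
      case False
      with supp_in_zero[of x X f] C(1) show ?thesis by (simp add: K_def C0_def)
    qed
  qed
  finally show "\<Lambda> f \<le> om V + om W" .
qed

lemma om_finite_Union:
  "finite I \<Longrightarrow> (\<And>i. i \<in> I \<Longrightarrow> openin X (V i)) \<Longrightarrow> om (\<Union>i\<in>I. V i) \<le> (\<Sum>i\<in>I. om (V i))"
proof (induction I rule: finite_induct)
  case (insert i I)
  then have "om (V i \<union> (\<Union>i\<in>I. V i)) \<le> om (V i) + om (\<Union>i\<in>I. V i)"
    by (intro om_Un) auto
  with insert show ?case by force
qed (simp add: om_empty)

text \<open>A function below the union has compact support, so finitely many of the sets already
  contain that support. The series is taken in \<open>ennreal\<close> because it may
  diverge.\<close>

lemma om_countable_Union:
  fixes V :: "nat \<Rightarrow> 'a set"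
  assumes V: "\<And>i. openin X (V i)"
  shows "ennreal (om (\<Union>i. V i)) \<le> (\<Sum>i. ennreal (om (V i)))"
proof -
  have le: "ennreal (\<Lambda> f) \<le> (\<Sum>i. ennreal (om (V i)))" if f: "fun_below X f (\<Union>i. V i)" for f
  proof -
    have "compactin X (supp_in X f)" "supp_in X f \<subseteq> \<Union>(range V)"
      using f by (auto simp: fun_below_def Cc_def)
    then obtain \<F> where \<F>: "finite \<F>" "\<F> \<subseteq> range V" "supp_in X f \<subseteq> \<Union>\<F>"
      using compactinD[of X "supp_in X f" "range V"] V by blast
    then obtain I where I: "finite I" "\<F> = V ` I"
      by (meson finite_subset_image)
    have "\<Lambda> f \<le> om (\<Union>i\<in>I. V i)"
      using f \<F>(3) I(2) by (intro om_upper) (auto simp: fun_below_def)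
    also have "\<dots> \<le> (\<Sum>i\<in>I. om (V i))"
      using I(1) V by (rule om_finite_Union)
    finally have "ennreal (\<Lambda> f) \<le> (\<Sum>i\<in>I. ennreal (om (V i)))"
      by (simp add: om_nonneg ennreal_leI sum_ennreal)
    also have "\<dots> \<le> (\<Sum>i. ennreal (om (V i)))"
      using I(1) by (intro sum_le_suminf) auto
    finally show ?thesis .
  qed
  show ?thesis
  proof (cases "(\<Sum>i. ennreal (om (V i)))")
    case (real r)
    have "om (\<Union>i. V i) \<le> r"
    proof (rule om_least)
      fix f assume "fun_below X f (\<Union>i. V i)"
      from le[OF this] real show "\<Lambda> f \<le> r" by (simp add: ennreal_le_iff)
    qed
    with real show ?thesis by (simp add: ennreal_leI)
  qed simp
qed

section \<open>The outer measure and Caratheodory's criterion\<close>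

definition outer :: "'a set \<Rightarrow> ennreal"
  where "outer A = (INF V\<in>{V. openin X V \<and> A \<subseteq> V}. ennreal (om V))"

lemma outer_le: "openin X V \<Longrightarrow> A \<subseteq> V \<Longrightarrow> outer A \<le> ennreal (om V)"
  unfolding outer_def by (rule INF_lower) auto

lemma outer_greatest: "(\<And>V. openin X V \<Longrightarrow> A \<subseteq> V \<Longrightarrow> c \<le> ennreal (om V)) \<Longrightarrow> c \<le> outer A"
  unfolding outer_def by (rule INF_greatest) auto

lemma outer_open: "openin X V \<Longrightarrow> outer V = ennreal (om V)"
  by (intro antisym outer_le outer_greatest) (auto intro: om_mono ennreal_leI)

lemma outer_mono: "A \<subseteq> B \<Longrightarrow> outer A \<le> outer B"
  by (rule outer_greatest) (auto intro: outer_le)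

lemma outer_finite: "A \<subseteq> topspace X \<Longrightarrow> outer A < \<infinity>"
  using outer_le[of "topspace X" A] by (auto intro: le_less_trans)

lemma outer_approx:
  assumes "A \<subseteq> topspace X" "e > 0"
  obtains V where "openin X V" "A \<subseteq> V" "ennreal (om V) < outer A + ennreal e"
proof -
  have "outer A < outer A + ennreal e"
    using outer_finite[OF assms(1)] assms(2) ennreal_add_left_cancel_less[of "outer A" 0 "ennreal e"]
    by auto
  then show ?thesis
    using that unfolding outer_def INF_less_iff by blast
qed

lemma outer_countable_subadditive:
  assumes A: "\<And>i::nat. A i \<subseteq> topspace X"
  shows "outer (\<Union>i. A i) \<le> (\<Sum>i. outer (A i))"
proof (rule ennreal_le_epsilon)
  fix e :: real assume e: "0 < e"
  \<comment> \<open>The exponent \<open>Suc i\<close> makes the errors add up to exactly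
    \<open>e\<close>, as \<open>i\<close> starts at 0.\<close>
  have "\<exists>V. openin X V \<and> A i \<subseteq> V \<and> ennreal (om V) \<le> outer (A i) + ennreal (e * (1 / 2) ^ Suc i)" for i
    using outer_approx[OF A, of "e * (1 / 2) ^ Suc i"] e by (metis half_gt_zero less_imp_le mult_pos_pos zero_less_power zero_less_one)
  then obtain V where V: "\<And>i. openin X (V i)" "\<And>i. A i \<subseteq> V i"
    "\<And>i. ennreal (om (V i)) \<le> outer (A i) + ennreal (e * (1 / 2) ^ Suc i)"
    by metis
  have "outer (\<Union>i. A i) \<le> ennreal (om (\<Union>i. V i))"
    using V(1,2) by (intro outer_le) auto
  also have "\<dots> \<le> (\<Sum>i. ennreal (om (V i)))"
    by (rule om_countable_Union) (rule V)
  also have "\<dots> \<le> (\<Sum>i. outer (A i) + ennreal (e * (1 / 2) ^ Suc i))"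
    by (intro suminf_le V) auto
  also have "\<dots> = (\<Sum>i. outer (A i)) + (\<Sum>i. ennreal (e * (1 / 2) ^ Suc i))"
    by (rule suminf_add[symmetric]) auto
  also have "(\<Sum>i. ennreal (e * (1 / 2) ^ Suc i)) = ennreal e"
    using sums_mult[OF power_half_series, of e] e by (intro suminf_ennreal_eq) auto
  finally show "outer (\<Union>i. A i) \<le> (\<Sum>i. outer (A i)) + ennreal e" .
qed

lemma outer_measure_space_outer: "outer_measure_space (Pow (topspace X)) outer"
proof -
  have "outer {} = 0"
    using outer_open[of "{}"] om_empty by simp
  then show ?thesis
    unfolding outer_measure_space_def positive_def increasing_def countably_subadditive_def
    using outer_mono outer_countable_subadditive by (auto simp: Pow_def image_subset_iff)
qed

text \<open>Only superadditivity has content. Inside an open \<open>U\<close> containing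
  \<open>A\<close>, first \<open>f\<close> is chosen below \<open>U \<inter> V\<close>, then
  \<open>g\<close> below \<open>U - supp_in X f\<close>, both nearly optimal, so that
  \<open>fun_below_add\<close> puts f + g below \<open>U\<close>. The part of \<open>A\<close>
  outside \<open>V\<close> still lies in \<open>U - supp_in X f\<close>.\<close>

lemma open_in_lambda_system:
  assumes V: "openin X V"
  shows "V \<in> lambda_system (topspace X) (Pow (topspace X)) outer"
proof -
  have "outer (V \<inter> A) + outer ((topspace X - V) \<inter> A) = outer A" if A: "A \<subseteq> topspace X" for A
  proof (rule antisym)
    interpret sigma_algebra "topspace X" "Pow (topspace X)" by (rule sigma_algebra_Pow)
    have "subadditive (Pow (topspace X)) outer"
      using outer_measure_space_outer countably_subadditive_subadditive
      by (auto simp: outer_measure_space_def)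
    then have "outer (V \<inter> A \<union> (topspace X - V) \<inter> A) \<le> outer (V \<inter> A) + outer ((topspace X - V) \<inter> A)"
      using A by (intro subadditiveD) auto
    moreover have "V \<inter> A \<union> (topspace X - V) \<inter> A = A" using A by auto
    ultimately show "outer A \<le> outer (V \<inter> A) + outer ((topspace X - V) \<inter> A)" by simp
  next
    show "outer (V \<inter> A) + outer ((topspace X - V) \<inter> A) \<le> outer A"
    proof (rule outer_greatest)
      fix U assume U: "openin X U" "A \<subseteq> U"
      have "outer (V \<inter> A) + outer ((topspace X - V) \<inter> A) \<le> ennreal (om U) + ennreal e" if e: "0 < e" for e
      proof -
        obtain f where f: "fun_below X f (U \<inter> V)" "om (U \<inter> V) - e / 2 < \<Lambda> f"
          using om_approx[of "e / 2"] e by (metis half_gt_zero)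
        obtain g where g: "fun_below X g (U - supp_in X f)" "om (U - supp_in X f) - e / 2 < \<Lambda> g"
          using om_approx[of "e / 2"] e by (metis half_gt_zero)
        have op: "openin X (U - supp_in X f)" "openin X (U \<inter> V)"
          using U V closedin_supp_in by auto
        have sub: "(topspace X - V) \<inter> A \<subseteq> U - supp_in X f" "V \<inter> A \<subseteq> U \<inter> V"
          using f(1) U(2) by (auto simp: fun_below_def)
        have "\<Lambda> (\<lambda>x. f x + g x) \<le> om U"
          using fun_below_add[OF fun_below_mono[OF f(1)] g(1)] by (intro om_upper) auto
        then have "om (U \<inter> V) + om (U - supp_in X f) \<le> om U + e"
          using f g add[OF fun_below_C0[OF f(1)] fun_below_C0[OF g(1)]] by simp
        then have "ennreal (om (U \<inter> V)) + ennreal (om (U - supp_in X f)) \<le> ennreal (om U) + ennreal e"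
          using e om_nonneg by (simp flip: ennreal_plus add: ennreal_leI)
        moreover have "outer (V \<inter> A) + outer ((topspace X - V) \<inter> A)
            \<le> ennreal (om (U \<inter> V)) + ennreal (om (U - supp_in X f))"
          using outer_le[OF op(2) sub(2)] outer_le[OF op(1) sub(1)] by (rule add_mono)
        ultimately show ?thesis by (rule order_trans[rotated])
      qed
      then show "outer (V \<inter> A) + outer ((topspace X - V) \<inter> A) \<le> ennreal (om U)"
        by (rule ennreal_le_epsilon)
    qed
  qed
  then show ?thesis
    using openin_subset[OF V] by (auto simp: lambda_system_def)
qed

section \<open>The Riesz measure and its integral\<close>

definition riesz :: "'a measure"
  where "riesz = measure_of (topspace X) {U. openin X U} outer"

lemma space_riesz [simp]: "space riesz = topspace X"
  unfolding riesz_def by (rule space_measure_of) (auto dest: openin_subset)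

lemma sets_riesz [simp]: "sets riesz = sets (borel_of X)"
  unfolding riesz_def sets_borel_of by (rule sets_measure_of) (auto dest: openin_subset)

text \<open>Caratheodory's measurable sets form a sigma-algebra containing the open sets, so
  \<open>outer\<close> is a measure on the Borel sets and \<open>measure_of\<close> returns it
  rather than its default.\<close>

lemma emeasure_riesz:
  assumes "A \<in> sets (borel_of X)"
  shows "emeasure riesz A = outer A"
proof (rule emeasure_measure_of[OF riesz_def])
  let ?L = "lambda_system (topspace X) (Pow (topspace X)) outer"
  interpret sigma_algebra "topspace X" "Pow (topspace X)" by (rule sigma_algebra_Pow)
  have ms: "measure_space (topspace X) ?L outer"
    by (rule caratheodory_lemma[OF outer_measure_space_outer])
  then have "sigma_sets (topspace X) {U. openin X U} \<subseteq> ?L"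
    using open_in_lambda_system
    by (intro sigma_algebra.sigma_sets_subset) (auto simp: measure_space_def)
  with ms show "countably_additive (sets riesz) outer"
    unfolding measure_space_def sets_riesz sets_borel_of
    by (auto simp: countably_additive_def)
  show "positive (sets riesz) outer"
    using ms by (auto simp: measure_space_def positive_def)
qed (use assms in \<open>auto dest: openin_subset\<close>)

lemma finite_measure_riesz: "finite_measure riesz"
  by (rule finite_measureI) (simp add: emeasure_riesz open_in_sets_borel_of outer_open)

lemma measure_riesz_open: "openin X V \<Longrightarrow> measure riesz V = om V"
  by (simp add: measure_def emeasure_riesz open_in_sets_borel_of outer_open om_nonneg)

lemma riesz_outer_regular:
  assumes "A \<in> sets (borel_of X)" "e > 0"
  obtains V where "openin X V" "A \<subseteq> V" "measure riesz V < measure riesz A + e"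
proof -
  interpret finite_measure riesz by (rule finite_measure_riesz)
  have "A \<subseteq> topspace X"
    using sets.sets_into_space[OF assms(1)] by simp
  from outer_approx[OF this assms(2)] obtain V
    where V: "openin X V" "A \<subseteq> V" "ennreal (om V) < outer A + ennreal e" .
  have "ennreal (measure riesz V) < ennreal (measure riesz A) + ennreal e"
    using V assms(1) by (simp add: measure_riesz_open emeasure_riesz flip: emeasure_eq_measure)
  then have "measure riesz V < measure riesz A + e"
    using assms(2) by (simp flip: ennreal_plus add: ennreal_less_iff)
  with V show ?thesis by (intro that)
qed

lemma C0_measurable_riesz: "f \<in> C0 X \<Longrightarrow> f \<in> borel_measurable riesz"
  unfolding measurable_cong_sets[OF sets_riesz refl]
  by (rule cont_functions_measurable) (simp add: C0_def)

lemma C0_integrable_riesz: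
  assumes "f \<in> C0 X"
  shows "integrable riesz f"
proof -
  interpret finite_measure riesz by (rule finite_measure_riesz)
  obtain B where "\<And>x. \<bar>f x\<bar> \<le> B"
    using C0_bounded[OF assms] by blast
  then show ?thesis
    using C0_measurable_riesz[OF assms] by (intro integrable_const_bound[where B = B]) auto
qed

text \<open>With \<open>V\<^sub>i = {f > i/N}\<close>, both \<open>\<Lambda>\<close> and the integral map the \<open>i\<close>-th layer \<open>g i\<close> of \<open>N f\<close> into the interval
  from \<open>om V\<^sub>i\<^sub>+\<^sub>1\<close> to \<open>om V\<^sub>i\<close>, and the lengths of these intervals telescope.\<close>

lemma integral_riesz_unit:
  assumes f: "f \<in> C0 X" "\<And>x. 0 \<le> f x" "\<And>x. f x \<le> 1"
  shows "integral\<^sup>L riesz f = \<Lambda> f"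
proof -
  interpret finite_measure riesz by (rule finite_measure_riesz)
  have "\<bar>integral\<^sup>L riesz f - \<Lambda> f\<bar> \<le> om (topspace X) / real N" if N: "N > 0" for N :: nat
  proof -
    define g where "g i x = min (max (real N * f x - real i) 0) 1" for i x
    define V where "V i = {x \<in> topspace X. real i / real N < f x}" for i
    have V: "openin X (V i)" for i
      using openin_superlevel f(1) unfolding V_def by (auto simp: C0_def)
    have g: "g i \<in> C0 X" for i
      using C0_comp[OF f(1), of "\<lambda>a. min (max (real N * a - real i) 0) 1"]
      by (simp add: g_def[abs_def] continuous_intros)
    have g01: "0 \<le> g i x" "g i x \<le> 1" for i x
      by (auto simp: g_def)
    have g0: "g i x = 0" if "x \<notin> V i" for i x
      using that N f(1) C0_outside[of f X x] by (auto simp: g_def V_def field_simps)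
    have g1: "g i x = 1" if "x \<in> V (Suc i)" for i x
      using that N by (auto simp: g_def V_def field_simps)
    have VS: "V (Suc i) \<in> sets riesz" "V i \<in> sets riesz" for i
      using V open_in_sets_borel_of by auto
    have ind: "integrable riesz (\<lambda>x. indicator (V i) x :: real)" for i
      using VS[of i] by (intro integrable_real_indicator) (auto simp: less_top[symmetric])
    have Iind: "(\<integral>x. indicator (V i) x \<partial>riesz) = om (V i)" for i
      using openin_subset[OF V, of i] by (simp add: measure_riesz_open[OF V] Int_absorb2)
    have \<Lambda>g: "om (V (Suc i)) \<le> \<Lambda> (g i)" "\<Lambda> (g i) \<le> om (V i)" for i
      using om_le[OF g g01(1)] le_om[OF g g01 g0] g1 by (auto simp: order_eq_refl)
    have "(\<integral>x. indicator (V (Suc i)) x \<partial>riesz) \<le> integral\<^sup>L riesz (g i)" for i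
      using g01(1) g1 by (intro integral_mono[OF ind C0_integrable_riesz[OF g]]) (auto simp: indicator_def)
    then have Ig1: "om (V (Suc i)) \<le> integral\<^sup>L riesz (g i)" for i
      by (simp only: Iind)
    have "integral\<^sup>L riesz (g i) \<le> (\<integral>x. indicator (V i) x \<partial>riesz)" for i
      using g01(2) g0 by (intro integral_mono[OF C0_integrable_riesz[OF g] ind]) (auto simp: indicator_def)
    then have Ig2: "integral\<^sup>L riesz (g i) \<le> om (V i)" for i
      by (simp only: Iind)
    \<comment> \<open>As \<open>f\<close> is at most 1, the minimum in \<open>sum_clamp\<close> is N
      f(x) itself.\<close>
    have Nf: "real N * f x = (\<Sum>i<N. g i x)" for x
      using sum_clamp[of "real N * f x" N] f(2,3)[of x] by (simp add: g_def mult_left_le)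
    have "real N * \<Lambda> f = (\<Sum>i<N. \<Lambda> (g i))"
      using scale[OF f(1), of "real N"] g by (simp add: Nf sum)
    moreover have "real N * integral\<^sup>L riesz f = (\<Sum>i<N. integral\<^sup>L riesz (g i))"
    proof -
      have "real N * integral\<^sup>L riesz f = (\<integral>x. real N * f x \<partial>riesz)" by simp
      also have "\<dots> = (\<Sum>i<N. integral\<^sup>L riesz (g i))"
        unfolding Nf by (intro Bochner_Integration.integral_sum C0_integrable_riesz g)
      finally show ?thesis .
    qed
    ultimately have "real N * (integral\<^sup>L riesz f - \<Lambda> f) = (\<Sum>i<N. integral\<^sup>L riesz (g i) - \<Lambda> (g i))"
      by (simp add: sum_subtractf right_diff_distrib)
    then have "real N * \<bar>integral\<^sup>L riesz f - \<Lambda> f\<bar> = \<bar>\<Sum>i<N. integral\<^sup>L riesz (g i) - \<Lambda> (g i)\<bar>"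
      by (metis abs_mult abs_of_nat)
    also have "\<dots> \<le> (\<Sum>i<N. om (V i) - om (V (Suc i)))"
    proof (rule order_trans[OF sum_abs sum_mono])
      fix i
      show "\<bar>integral\<^sup>L riesz (g i) - \<Lambda> (g i)\<bar> \<le> om (V i) - om (V (Suc i))"
        using \<Lambda>g[of i] Ig1[of i] Ig2[of i] by linarith
    qed
    also have "\<dots> = om (V 0) - om (V N)"
      by (rule sum_lessThan_telescope')
    also have "\<dots> \<le> om (topspace X)"
      using om_nonneg[of "V N"] om_le_topspace[of "V 0"] by linarith
    finally show ?thesis
      using N by (simp add: field_simps)
  qed
  then have "\<forall>\<^sub>F N in sequentially. \<bar>integral\<^sup>L riesz f - \<Lambda> f\<bar> \<le> om (topspace X) / real N"
    using eventually_gt_at_top[of 0] by (rule eventually_mono[rotated])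
  moreover have "(\<lambda>N. om (topspace X) / real N) \<longlonglongrightarrow> 0"
    by (rule lim_const_over_n)
  ultimately have "\<bar>integral\<^sup>L riesz f - \<Lambda> f\<bar> \<le> 0"
    by (intro tendsto_lowerbound) auto
  then show ?thesis by simp
qed

lemma integral_riesz_nonneg:
  assumes f: "f \<in> C0 X" "\<And>x. 0 \<le> f x"
  shows "integral\<^sup>L riesz f = \<Lambda> f"
proof -
  obtain B where B: "B > 0" "\<And>x. \<bar>f x\<bar> \<le> B"
    using C0_bounded[OF f(1)] by blast
  have "integral\<^sup>L riesz (\<lambda>x. (1 / B) * f x) = \<Lambda> (\<lambda>x. (1 / B) * f x)"
    using B f by (intro integral_riesz_unit C0_cmult) (auto simp: abs_le_iff)
  with B(1) show ?thesis by (simp only: scale[OF f(1)]) simp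
qed

text \<open>|f| and |f| - f are nonnegative elements of \<open>C0 X\<close> whose difference is
  \<open>f\<close>.\<close>

theorem integral_riesz:
  assumes f: "f \<in> C0 X"
  shows "integral\<^sup>L riesz f = \<Lambda> f"
proof -
  have C: "(\<lambda>x. \<bar>f x\<bar>) \<in> C0 X" "(\<lambda>x. \<bar>f x\<bar> - f x) \<in> C0 X"
    using C0_abs[OF f] C0_diff[OF C0_abs[OF f] f] by auto
  have "integral\<^sup>L riesz (\<lambda>x. \<bar>f x\<bar> - f x) = \<Lambda> (\<lambda>x. \<bar>f x\<bar>) - \<Lambda> f"
    using integral_riesz_nonneg[OF C(2)] diff[OF C(1) f] by simp
  then show ?thesis
    using integral_riesz_nonneg[OF C(1)] C0_integrable_riesz[OF C(1)] C0_integrable_riesz[OF f] by simp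
qed

end

section \<open>Suprema in normal ordered vector spaces\<close>

lemma isLub_UNIV_iff: "isLub UNIV D s \<longleftrightarrow> (\<forall>d\<in>D. d \<le> s) \<and> (\<forall>u. (\<forall>d\<in>D. d \<le> u) \<longrightarrow> s \<le> u)"
  by (auto simp: isLub_def leastP_def isUb_def setle_def setge_def)

lemma isGlb_UNIV_iff: "isGlb UNIV D s \<longleftrightarrow> (\<forall>d\<in>D. s \<le> d) \<and> (\<forall>u. (\<forall>d\<in>D. u \<le> d) \<longrightarrow> u \<le> s)"
  by (auto simp: isGlb_def greatestP_def isLb_def setle_def setge_def)

lemma isLub_UNIV_unique: "isLub UNIV D s \<Longrightarrow> isLub UNIV D t \<Longrightarrow> s = (t::'a::order)"
  unfolding isLub_UNIV_iff by (meson antisym)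

lemma isGlb_UNIV_unique: "isGlb UNIV D s \<Longrightarrow> isGlb UNIV D t \<Longrightarrow> s = (t::'a::order)"
  unfolding isGlb_UNIV_iff by (meson antisym)

lemma isLub_realI:
  fixes s :: real
  assumes "\<And>d. d \<in> D \<Longrightarrow> d \<le> s" "\<And>e. 0 < e \<Longrightarrow> \<exists>d\<in>D. s - e < d"
  shows "isLub UNIV D s"
  unfolding isLub_UNIV_iff
proof (intro conjI ballI allI impI)
  fix u assume u: "\<forall>d\<in>D. d \<le> u"
  show "s \<le> u"
  proof (rule ccontr)
    assume "\<not> s \<le> u"
    with assms(2)[of "s - u"] u show False by force
  qed
qed (use assms in auto)

lemma isGlb_realI:
  fixes s :: real
  assumes "\<And>d. d \<in> D \<Longrightarrow> s \<le> d" "\<And>e. 0 < e \<Longrightarrow> \<exists>d\<in>D. d < s + e"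
  shows "isGlb UNIV D s"
  unfolding isGlb_UNIV_iff
proof (intro conjI ballI allI impI)
  fix u assume u: "\<forall>d\<in>D. u \<le> d"
  show "u \<le> s"
  proof (rule ccontr)
    assume "\<not> u \<le> s"
    with assms(2)[of "u - s"] u show False by force
  qed
qed (use assms in auto)

lemma isLub_incseq_real:
  fixes a :: "nat \<Rightarrow> real"
  assumes "incseq a" "a \<longlonglongrightarrow> l"
  shows "isLub UNIV (range a) l"
  unfolding isLub_UNIV_iff using incseq_le[OF assms] assms(2)
  by (auto intro: LIMSEQ_le_const2)

lemma incseq_isLub_real:
  fixes a :: "nat \<Rightarrow> real"
  assumes "incseq a" "isLub UNIV (range a) l"
  shows "a \<longlonglongrightarrow> l"
proof -
  have b: "bdd_above (range a)"
    using assms(2) by (auto simp: isLub_UNIV_iff)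
  have "isLub UNIV (range a) (SUP n. a n)"
    using LIMSEQ_incseq_SUP[OF b assms(1)] by (rule isLub_incseq_real[OF assms(1)])
  then have "(SUP n. a n) = l"
    using assms(2) by (rule isLub_UNIV_unique)
  then show ?thesis
    using LIMSEQ_incseq_SUP[OF b assms(1)] by simp
qed

text \<open>The only new candidate for an upper bound is \<open>Infty\<close>, which lies above
  \<open>Fin s\<close> anyway.\<close>

lemma isLub_Fin_image: "isLub UNIV (Fin ` D) (Fin s) \<longleftrightarrow> isLub UNIV D s"
proof -
  have "(\<forall>u. (\<forall>d\<in>D. Fin d \<le> u) \<longrightarrow> Fin s \<le> u) \<longleftrightarrow> (\<forall>u. (\<forall>d\<in>D. d \<le> u) \<longrightarrow> s \<le> u)"
    by (metis ext.exhaust less_eq_ext.simps(1,3))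
  then show ?thesis by (simp add: isLub_UNIV_iff)
qed

text \<open>An element of \<open>D\<close> excludes \<open>Infty\<close> as a lower bound; for the
  empty set it would be one.\<close>

lemma isGlb_Fin_image:
  assumes "D \<noteq> {}"
  shows "isGlb UNIV (Fin ` D) (Fin s) \<longleftrightarrow> isGlb UNIV D s"
proof -
  have "(\<forall>u. (\<forall>d\<in>D. u \<le> Fin d) \<longrightarrow> u \<le> Fin s) \<longleftrightarrow> (\<forall>u. (\<forall>d\<in>D. u \<le> d) \<longrightarrow> u \<le> s)"
    using assms by (metis all_not_in_conv ext.exhaust less_eq_ext.simps(2,3))
  then show ?thesis by (simp add: isGlb_UNIV_iff)
qed

lemma le_Fin_iff: "x \<le> Fin s \<longleftrightarrow> (\<exists>e. x = Fin e \<and> e \<le> s)"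
  by (cases x) auto

lemma sum_Fin: "(\<Sum>i\<in>I. Fin (a i)) = Fin (\<Sum>i\<in>I. a i :: 'a::comm_monoid_add)"
  by (induction I rule: infinite_finite_induct) (auto simp: zero_ext_def)

section \<open>Positive functionals, suprema and normality\<close>

lemma positive_functional_linear: "positive_functional x' \<Longrightarrow> linear x'"
  by (simp add: positive_functional_def)

lemma positive_functional_mono:
  assumes "positive_functional x'" "x \<le> y"
  shows "x' x \<le> x' y"
proof -
  have "0 \<le> x' (y - x)"
    using assms by (simp add: positive_functional_def)
  then show ?thesis
    using linear_diff[OF positive_functional_linear[OF assms(1)]] by simp
qed

lemma positive_oc_functional_linear: "positive_oc_functional x' \<Longrightarrow> linear x'"
  by (simp add: positive_oc_functional_def positive_functional_def)

lemma positive_oc_functional_mono: "positive_oc_functional x' \<Longrightarrow> x \<le> y \<Longrightarrow> x' x \<le> x' y"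
  by (simp add: positive_oc_functional_def positive_functional_mono)

text \<open>Order continuity speaks of nets decreasing to 0; the differences s - d form such a
  net.\<close>

lemma positive_oc_functional_isLub:
  assumes x': "positive_oc_functional x'" and D: "up_directed D" and s: "isLub UNIV D s"
  shows "isLub UNIV (x' ` D) (x' s)"
proof -
  let ?D = "(\<lambda>d. s - d) ` D"
  have "down_directed ?D"
    using D unfolding up_directed_def down_directed_def by force
  moreover have "isGlb UNIV ?D 0"
    unfolding isGlb_UNIV_iff
  proof (intro conjI allI impI)
    fix u assume "\<forall>d\<in>?D. u \<le> d"
    then have "\<forall>d\<in>D. d \<le> s - u" by (auto simp: algebra_simps)
    with s have "s \<le> s - u" by (simp add: isLub_UNIV_iff)
    then show "u \<le> 0" by simp
  qed (use s in \<open>auto simp: isLub_UNIV_iff\<close>)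
  ultimately have G: "isGlb UNIV (x' ` ?D) 0"
    using x' by (simp add: positive_oc_functional_def)
  have lin: "x' (s - d) = x' s - x' d" for d
    by (rule linear_diff[OF positive_oc_functional_linear[OF x']])
  show ?thesis
    unfolding isLub_UNIV_iff
  proof (intro conjI allI impI)
    show "\<forall>d\<in>x' ` D. d \<le> x' s"
      using G by (auto simp: isGlb_UNIV_iff lin)
    fix u assume "\<forall>d\<in>x' ` D. d \<le> u"
    then have "\<forall>d\<in>x' ` ?D. x' s - u \<le> d" by (auto simp: lin)
    with G have "x' s - u \<le> 0" by (simp only: isGlb_UNIV_iff)
    then show "x' s \<le> u" by simp
  qed
qed

lemma up_directed_incseq: "incseq a \<Longrightarrow> up_directed (range a)"
  unfolding up_directed_def by (auto simp: incseq_def) (metis linear)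

lemma positive_oc_functional_incseq:
  assumes x': "positive_oc_functional x'" and a: "incseq a" "isLub UNIV (range a) s"
  shows "(\<lambda>n. x' (a n)) \<longlonglongrightarrow> x' s"
proof (rule incseq_isLub_real)
  show "incseq (\<lambda>n. x' (a n))"
    using a(1) positive_oc_functional_mono[OF x'] by (auto simp: incseq_def)
  show "isLub UNIV (range (\<lambda>n. x' (a n))) (x' s)"
    using positive_oc_functional_isLub[OF x' up_directed_incseq[OF a(1)] a(2)]
    by (simp add: image_image)
qed

lemma normal_le:
  assumes "normal_space_ov TYPE('e::ordered_real_vector)"
    and le: "\<And>x'. positive_oc_functional x' \<Longrightarrow> x' x \<le> x' (y::'e)"
  shows "x \<le> y"
proof -
  have "0 \<le> x' (y - x)" if "positive_oc_functional x'" for x'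
    using le[OF that] linear_diff[OF positive_oc_functional_linear[OF that]] by simp
  then have "0 \<le> y - x"
    using assms(1) unfolding normal_space_ov_def by blast
  then show ?thesis by simp
qed

lemma normal_eq:
  assumes "normal_space_ov TYPE('e::ordered_real_vector)"
    and eq: "\<And>x'. positive_oc_functional x' \<Longrightarrow> x' x = x' (y::'e)"
  shows "x = y"
proof (rule antisym)
  show "x \<le> y"
    by (rule normal_le[OF assms(1)]) (rule eq_refl[OF eq])
  show "y \<le> x"
    by (rule normal_le[OF assms(1)]) (rule eq_refl[OF eq[symmetric]])
qed

text \<open>In contrast to \<open>positive_oc_functional_isLub\<close>, the set \<open>D\<close> is
  arbitrary: an upper bound of \<open>D\<close> is mapped to an upper bound of each image, and the
  inequalities between real numbers lift to E by \<open>normal_le\<close>.\<close>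

lemma normal_isLub:
  assumes N: "normal_space_ov TYPE('e::ordered_real_vector)"
    and L: "\<And>x'. positive_oc_functional x' \<Longrightarrow> isLub UNIV (x' ` D) (x' (s::'e))"
  shows "isLub UNIV D s"
  unfolding isLub_UNIV_iff
proof (intro conjI ballI allI impI)
  show "d \<le> s" if "d \<in> D" for d
    using L that by (intro normal_le[OF N]) (simp add: isLub_UNIV_iff)
  show "s \<le> u" if "\<forall>d\<in>D. d \<le> u" for u
  proof (rule normal_le[OF N])
    fix x' :: "'e \<Rightarrow> real" assume x': "positive_oc_functional x'"
    have "\<forall>r\<in>x' ` D. r \<le> x' u"
      using that positive_oc_functional_mono[OF x'] by auto
    with L[OF x'] show "x' s \<le> x' u" by (simp only: isLub_UNIV_iff)
  qed
qed

lemma normal_isGlb: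
  assumes N: "normal_space_ov TYPE('e::ordered_real_vector)"
    and L: "\<And>x'. positive_oc_functional x' \<Longrightarrow> isGlb UNIV (x' ` D) (x' (s::'e))"
  shows "isGlb UNIV D s"
  unfolding isGlb_UNIV_iff
proof (intro conjI ballI allI impI)
  show "s \<le> d" if "d \<in> D" for d
    using L that by (intro normal_le[OF N]) (simp add: isGlb_UNIV_iff)
  show "u \<le> s" if "\<forall>d\<in>D. u \<le> d" for u
  proof (rule normal_le[OF N])
    fix x' :: "'e \<Rightarrow> real" assume x': "positive_oc_functional x'"
    have "\<forall>r\<in>x' ` D. x' u \<le> r"
      using that positive_oc_functional_mono[OF x'] by auto
    with L[OF x'] show "x' u \<le> x' s" by (simp only: isGlb_UNIV_iff)
  qed
qed

section \<open>Order integrals and scalar integrals\<close>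

text \<open>\<open>m x'\<close> is the real measure \<open>\<Delta> \<mapsto> x'(\<nu>(\<Delta> \<inter> S))\<close>; by normality these measures determine all
  order integrals of functions vanishing outside \<open>S\<close>.\<close>

locale scalar_measures =
  fixes M :: "'a measure" and \<nu> :: "'a set \<Rightarrow> 'e::ordered_real_vector ext" and S :: "'a set"
    and m :: "('e \<Rightarrow> real) \<Rightarrow> 'a measure"
  assumes normal: "normal_space_ov TYPE('e)"
    and finite_m: "\<And>x'. positive_oc_functional x' \<Longrightarrow> finite_measure (m x')"
    and sets_m: "\<And>x'. positive_oc_functional x' \<Longrightarrow> sets (m x') = sets M"
    and scalar_value: "\<And>\<Delta>. \<Delta> \<in> sets M \<Longrightarrow>
      \<exists>e. \<nu> (\<Delta> \<inter> S) = Fin e \<and> (\<forall>x'. positive_oc_functional x' \<longrightarrow> measure (m x') \<Delta> = x' e)"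
begin

lemma space_m: "positive_oc_functional x' \<Longrightarrow> space (m x') = space M"
  by (rule sets_eq_imp_space_eq[OF sets_m])

lemma measurable_m: "positive_oc_functional x' \<Longrightarrow> measurable (m x') N = measurable M N"
  by (rule measurable_cong_sets[OF sets_m refl])

lemma elementary_integral_Fin:
  assumes \<phi>: "elementary M \<phi>" "\<And>x. x \<in> space M - S \<Longrightarrow> \<phi> x = 0"
  obtains a where "elementary_integral M \<nu> \<phi> = Fin a"
    "\<And>x'. positive_oc_functional x' \<Longrightarrow> has_bochner_integral (m x') \<phi> (x' a)"
proof -
  have sf: "simple_function M \<phi>" "\<And>x. x \<in> space M \<Longrightarrow> 0 \<le> \<phi> x"
    using \<phi>(1) by (auto simp: elementary_def)
  have ms: "\<phi> -` {r} \<inter> space M \<in> sets M" for r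
    using sf(1) by (rule simple_functionD)
  obtain e where e: "\<And>\<Delta>. \<Delta> \<in> sets M \<Longrightarrow> \<nu> (\<Delta> \<inter> S) = Fin (e \<Delta>)"
    "\<And>\<Delta> x'. \<Delta> \<in> sets M \<Longrightarrow> positive_oc_functional x' \<Longrightarrow> measure (m x') \<Delta> = x' (e \<Delta>)"
    using scalar_value by metis
  define a where "a = (\<Sum>r\<in>\<phi> ` space M. r *\<^sub>R e (\<phi> -` {r} \<inter> space M))"
  show thesis
  proof (rule that)
    \<comment> \<open>The level set of 0 may leave \<open>S\<close> and have the value
      \<open>Infty\<close>; the convention that 0 times \<open>Infty\<close> is 0 discards it. All
      other level sets lie in \<open>S\<close>, where \<open>\<nu>\<close> is finite.\<close>
    have "ext_scale r (\<nu> (\<phi> -` {r} \<inter> space M)) = Fin (r *\<^sub>R e (\<phi> -` {r} \<inter> space M))" for r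
    proof (cases "r = 0")
      case True
      then show ?thesis by (cases "\<nu> (\<phi> -` {r} \<inter> space M)") (auto simp: zero_ext_def)
    next
      case False
      then have "\<phi> -` {r} \<inter> space M = \<phi> -` {r} \<inter> space M \<inter> S"
        using \<phi>(2) by auto
      then show ?thesis using e(1)[OF ms, of r] by simp
    qed
    then show "elementary_integral M \<nu> \<phi> = Fin a"
      by (simp add: elementary_integral_def a_def sum_Fin)
    fix x' :: "'e \<Rightarrow> real" assume x': "positive_oc_functional x'"
    interpret finite_measure "m x'" by (rule finite_m[OF x'])
    have "Bochner_Integration.simple_bochner_integrable (m x') \<phi>"
    proof (rule Bochner_Integration.simple_bochner_integrable.intros)
      show "simple_function (m x') \<phi>"
        using sf(1) by (simp add: simple_function_def space_m[OF x'] sets_m[OF x'])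
    qed simp
    then have "has_bochner_integral (m x') \<phi> (Bochner_Integration.simple_bochner_integral (m x') \<phi>)"
      by (rule has_bochner_integral_simple_bochner_integrable)
    moreover have "Bochner_Integration.simple_bochner_integral (m x') \<phi> = x' a"
    proof -
      have lin: "linear x'" by (rule positive_oc_functional_linear[OF x'])
      have "{x \<in> space M. \<phi> x = r} = \<phi> -` {r} \<inter> space M" for r by auto
      then show ?thesis
        using e(2)[OF ms x']
        by (simp add: Bochner_Integration.simple_bochner_integral_def a_def linear_sum[OF lin] linear_scale[OF lin]
            space_m[OF x'] mult.commute)
    qed
    ultimately show "has_bochner_integral (m x') \<phi> (x' a)" by simp
  qed
qed

text \<open>The bridge from order integrals to Lebesgue integrals. Elementary integrals increase in
  E; by order continuity and normality their supremum is \<open>p\<close> exactly if their images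
  under each x' converge to x'(p), and monotone or dominated convergence identifies this limit with
  the integral of \<open>g\<close>. The right-hand side does not mention the approximating sequence,
  so the order integral is independent of it.\<close>

lemma has_nn_order_integral_Fin_iff:
  assumes g: "g \<in> borel_measurable M" "\<And>x. x \<in> space M \<Longrightarrow> 0 \<le> g x"
    "\<And>x. x \<in> space M - S \<Longrightarrow> g x = 0"
  shows "has_nn_order_integral M \<nu> (\<lambda>x. ennreal (g x)) (Fin p) \<longleftrightarrow>
    (\<forall>x'. positive_oc_functional x' \<longrightarrow> has_bochner_integral (m x') g (x' p))"
    (is "?L \<longleftrightarrow> ?R")
proof -
  \<comment> \<open>Shown for every approximating sequence: the forward implication is handed one,
    the backward implication may choose one.\<close>
  have approx: "(isLub UNIV (range (\<lambda>n. elementary_integral M \<nu> (\<phi> n))) (Fin p)) \<longleftrightarrow> ?R"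
    if el: "\<And>n. elementary M (\<phi> n)" and inc: "\<And>x. x \<in> space M \<Longrightarrow> incseq (\<lambda>n. \<phi> n x)"
      and lim: "\<And>x. x \<in> space M \<Longrightarrow> (\<lambda>n. \<phi> n x) \<longlonglongrightarrow> g x" for \<phi> :: "nat \<Rightarrow> 'a \<Rightarrow> real"
  proof -
    have pos: "0 \<le> \<phi> n x" if "x \<in> space M" for n x
      using el that by (simp add: elementary_def)
    have le: "\<phi> n x \<le> g x" if "x \<in> space M" for n x
      using incseq_le[OF inc[OF that] lim[OF that]] .
    have z: "\<phi> n x = 0" if "x \<in> space M - S" for n x
      using pos[of x n] le[of x n] g(3)[OF that] that by auto
    have "\<exists>a. elementary_integral M \<nu> (\<phi> n) = Fin a \<and>
      (\<forall>x'. positive_oc_functional x' \<longrightarrow> has_bochner_integral (m x') (\<phi> n) (x' a))" for n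
      using elementary_integral_Fin[OF el z] by metis
    then obtain a where a: "\<And>n. elementary_integral M \<nu> (\<phi> n) = Fin (a n)"
      "\<And>n x'. positive_oc_functional x' \<Longrightarrow> has_bochner_integral (m x') (\<phi> n) (x' (a n))"
      by metis
    have mono: "x' (a i) \<le> x' (a j)" if x': "positive_oc_functional x'" and "i \<le> j" for x' i j
    proof -
      have "integral\<^sup>L (m x') (\<phi> i) \<le> integral\<^sup>L (m x') (\<phi> j)"
        using a(2)[OF x'] inc \<open>i \<le> j\<close>
        by (intro integral_mono) (auto simp: has_bochner_integral_iff space_m[OF x'] incseq_def)
      then show ?thesis
        by (simp add: has_bochner_integral_integral_eq[OF a(2)[OF x']])
    qed
    then have inca: "incseq a"
      by (auto simp: incseq_def intro!: normal_le[OF normal])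
    have R: "(isLub UNIV (range (\<lambda>n. elementary_integral M \<nu> (\<phi> n))) (Fin p)) \<longleftrightarrow> isLub UNIV (range a) p"
      using isLub_Fin_image[of "range a" p] by (simp add: a(1) image_image)
    show ?thesis
      unfolding R
    proof
      assume L: "isLub UNIV (range a) p"
      show ?R
      proof (intro allI impI)
        fix x' :: "'e \<Rightarrow> real" assume x': "positive_oc_functional x'"
        have "(\<lambda>n. integral\<^sup>L (m x') (\<phi> n)) \<longlonglongrightarrow> x' p"
          using positive_oc_functional_incseq[OF x' inca L]
          by (simp add: has_bochner_integral_integral_eq[OF a(2)[OF x']])
        then show "has_bochner_integral (m x') g (x' p)"
          using a(2)[OF x'] inc lim g(1)
          by (intro has_bochner_integral_monotone_convergence[where f = \<phi>])
            (auto simp: space_m[OF x'] measurable_m[OF x'] has_bochner_integral_iff mono_def incseq_def)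
      qed
    next
      assume R: ?R
      show "isLub UNIV (range a) p"
      proof (rule normal_isLub[OF normal])
        fix x' :: "'e \<Rightarrow> real" assume x': "positive_oc_functional x'"
        have gi: "has_bochner_integral (m x') g (x' p)"
          using R x' by blast
        have "(\<lambda>n. integral\<^sup>L (m x') (\<phi> n)) \<longlonglongrightarrow> integral\<^sup>L (m x') g"
        proof (rule integral_dominated_convergence[where w = g])
          show "g \<in> borel_measurable (m x')" "integrable (m x') g"
            using gi by (auto simp: has_bochner_integral_iff)
          show "\<phi> n \<in> borel_measurable (m x')" for n
            using a(2)[OF x', of n] by (auto simp: has_bochner_integral_iff)
        qed (use lim le pos in \<open>auto simp: space_m[OF x']\<close>)
        then have "(\<lambda>n. x' (a n)) \<longlonglongrightarrow> x' p"
          by (simp add: has_bochner_integral_integral_eq[OF a(2)[OF x']] has_bochner_integral_integral_eq[OF gi])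
        moreover have "incseq (\<lambda>n. x' (a n))"
          using mono[OF x'] by (auto simp: incseq_def)
        ultimately show "isLub UNIV (x' ` range a) (x' p)"
          using isLub_incseq_real by (simp add: image_image)
      qed
    qed
  qed
  show ?thesis
  proof
    assume ?L
    then obtain \<phi> :: "nat \<Rightarrow> 'a \<Rightarrow> real" where \<phi>: "\<And>n. elementary M (\<phi> n)"
      "\<And>x. x \<in> space M \<Longrightarrow> incseq (\<lambda>n. \<phi> n x)"
      "\<And>x. x \<in> space M \<Longrightarrow> (\<lambda>n. ennreal (\<phi> n x)) \<longlonglongrightarrow> ennreal (g x)"
      "isLub UNIV (range (\<lambda>n. elementary_integral M \<nu> (\<phi> n))) (Fin p)"
      unfolding has_nn_order_integral_def by blast
    have "(\<lambda>n. \<phi> n x) \<longlonglongrightarrow> g x" if "x \<in> space M" for x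
      using \<phi>(1) \<phi>(3)[OF that] g(2)[OF that] that
      by (subst (asm) tendsto_ennreal_iff) (auto simp: elementary_def)
    then show ?R using approx[OF \<phi>(1,2)] \<phi>(4) by blast
  next
    assume R: ?R
    \<comment> \<open>\<open>g\<close> is nonnegative only on \<open>space M\<close>; the truncation
      is so everywhere and agrees with \<open>g\<close> there.\<close>
    have "(\<lambda>x. max 0 (g x)) \<in> borel_measurable M"
      using g(1) by measurable
    then obtain \<phi> where \<phi>: "incseq \<phi>" "\<And>n. simple_function M (\<phi> n)"
      "\<And>x. bdd_above (range (\<lambda>n. \<phi> n x))" "\<And>n x. 0 \<le> \<phi> n x"
      "(\<lambda>x. max 0 (g x)) = (SUP n. \<phi> n)"
      using borel_measurable_implies_simple_function_sequence_real[of "\<lambda>x. max 0 (g x)" M] by auto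
    have inc: "incseq (\<lambda>n. \<phi> n x)" for x
      using \<phi>(1) by (auto simp: incseq_def le_fun_def)
    have "(\<lambda>n. \<phi> n x) \<longlonglongrightarrow> g x" if "x \<in> space M" for x
    proof -
      have "(SUP n. \<phi> n x) = g x"
        using fun_cong[OF \<phi>(5), of x] g(2)[OF that] by (simp add: image_image)
      with LIMSEQ_incseq_SUP[OF \<phi>(3) inc, of x] show ?thesis by simp
    qed
    moreover have "elementary M (\<phi> n)" for n
      using \<phi> by (simp add: elementary_def)
    ultimately show ?L
      unfolding has_nn_order_integral_def
      using g(1) approx[of \<phi>] R inc
      by (intro conjI exI[of _ \<phi>]) (auto intro: tendsto_ennrealI)
  qed
qed

text \<open>An element \<open>Q\<close> for |f| is asked for because E need not be a lattice, so a
  positive part cannot be taken of \<open>P\<close>. Positive and negative part of \<open>f\<close>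
  are (|f| + f)/2 and (|f| - f)/2, hence their integrals are linear combinations of \<open>P\<close>
  and \<open>Q\<close>.\<close>

lemma order_integral_eqI:
  assumes f: "f \<in> borel_measurable M" "\<And>x. x \<in> space M - S \<Longrightarrow> f x = 0"
    and P: "\<And>x'. positive_oc_functional x' \<Longrightarrow> has_bochner_integral (m x') f (x' P)"
    and Q: "\<And>x'. positive_oc_functional x' \<Longrightarrow> has_bochner_integral (m x') (\<lambda>x. \<bar>f x\<bar>) (x' Q)"
  shows "order_integrable M \<nu> f" "order_integral M \<nu> f = P"
proof -
  have ms: "(\<lambda>x. \<bar>f x\<bar>) \<in> borel_measurable M" "(\<lambda>x. max 0 (f x)) \<in> borel_measurable M"
    "(\<lambda>x. max 0 (- f x)) \<in> borel_measurable M"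
    using f(1) by measurable
  have "has_nn_order_integral M \<nu> (\<lambda>x. ennreal \<bar>f x\<bar>) (Fin Q)"
    using ms f(2) Q by (subst has_nn_order_integral_Fin_iff) auto
  then show "order_integrable M \<nu> f"
    using f(1) by (auto simp: order_integrable_def)
  define p where "p = (1 / 2) *\<^sub>R (Q + P)"
  define q where "q = (1 / 2) *\<^sub>R (Q - P)"
  have "p - q = P"
    by (simp add: p_def q_def flip: scaleR_right_diff_distrib scaleR_2)
  have iff1: "has_nn_order_integral M \<nu> (\<lambda>x. ennreal (max 0 (f x))) (Fin u) \<longleftrightarrow>
    (\<forall>x'. positive_oc_functional x' \<longrightarrow> has_bochner_integral (m x') (\<lambda>x. max 0 (f x)) (x' u))" for u
    using ms f(2) by (intro has_nn_order_integral_Fin_iff) auto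
  have iff2: "has_nn_order_integral M \<nu> (\<lambda>x. ennreal (max 0 (- f x))) (Fin u) \<longleftrightarrow>
    (\<forall>x'. positive_oc_functional x' \<longrightarrow> has_bochner_integral (m x') (\<lambda>x. max 0 (- f x)) (x' u))" for u
    using ms f(2) by (intro has_nn_order_integral_Fin_iff) auto
  have p: "has_bochner_integral (m x') (\<lambda>x. max 0 (f x)) (x' p)"
    and q: "has_bochner_integral (m x') (\<lambda>x. max 0 (- f x)) (x' q)"
    if x': "positive_oc_functional x'" for x'
  proof -
    have lin: "linear x'" by (rule positive_oc_functional_linear[OF x'])
    have eq: "max 0 (f x) = (1 / 2) * (\<bar>f x\<bar> + f x)" "max 0 (- f x) = (1 / 2) * (\<bar>f x\<bar> - f x)" for x
      by auto
    show "has_bochner_integral (m x') (\<lambda>x. max 0 (f x)) (x' p)"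
      "has_bochner_integral (m x') (\<lambda>x. max 0 (- f x)) (x' q)"
      unfolding eq p_def q_def linear_scale[OF lin] linear_add[OF lin] linear_diff[OF lin] real_scaleR_def
      by (intro has_bochner_integral_mult_right has_bochner_integral_add has_bochner_integral_diff P Q x')+
  qed
  show "order_integral M \<nu> f = P"
    unfolding order_integral_def
  proof (rule the_equality)
    show "\<exists>p q. has_nn_order_integral M \<nu> (\<lambda>x. ennreal (max 0 (f x))) (Fin p) \<and>
      has_nn_order_integral M \<nu> (\<lambda>x. ennreal (max 0 (- f x))) (Fin q) \<and> P = p - q"
      using p q \<open>p - q = P\<close> unfolding iff1 iff2 by blast
  next
    fix e assume "\<exists>p q. has_nn_order_integral M \<nu> (\<lambda>x. ennreal (max 0 (f x))) (Fin p) \<and>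
      has_nn_order_integral M \<nu> (\<lambda>x. ennreal (max 0 (- f x))) (Fin q) \<and> e = p - q"
    then obtain u v where uv:
      "\<And>x'. positive_oc_functional x' \<Longrightarrow> has_bochner_integral (m x') (\<lambda>x. max 0 (f x)) (x' u)"
      "\<And>x'. positive_oc_functional x' \<Longrightarrow> has_bochner_integral (m x') (\<lambda>x. max 0 (- f x)) (x' v)"
      "e = u - v"
      unfolding iff1 iff2 by blast
    \<comment> \<open>The definite description has one value: scalar integrals are unique, and
      normality separates the points of E.\<close>
    have "u = p"
      using has_bochner_integral_eq[OF uv(1) p] by (rule normal_eq[OF normal])
    moreover have "v = q"
      using has_bochner_integral_eq[OF uv(2) q] by (rule normal_eq[OF normal])
    ultimately show "e = P"
      using \<open>p - q = P\<close> uv(3) by simp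
  qed
qed

end

section \<open>Measures with values in the extended cone\<close>

lemma ext_measure_mono:
  assumes \<nu>: "ext_measure M \<nu>" and AB: "A \<in> sets M" "B \<in> sets M" "A \<subseteq> B"
  shows "\<nu> A \<le> \<nu> B"
proof -
  \<comment> \<open>With \<open>A\<close> in position 0 the first partial sum is the value at
    \<open>A\<close>; this avoids subtraction, which is meaningless at \<open>Infty\<close>.\<close>
  define D where "D n = (if n = 0 then A else if n = 1 then B - A else {})" for n :: nat
  have "range D \<subseteq> sets M" "disjoint_family D"
    using AB by (auto simp: D_def disjoint_family_on_def)
  then have "isLub UNIV (range (\<lambda>N. \<Sum>n\<le>N. \<nu> (D n))) (\<nu> (\<Union>n. D n))"
    using \<nu> by (simp add: ext_measure_def)
  then have "(\<Sum>n\<le>0. \<nu> (D n)) \<le> \<nu> (\<Union>n. D n)"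
    unfolding isLub_UNIV_iff by blast
  moreover have "(\<Union>n. D n) = B"
    using AB(3) by (auto simp: D_def split: if_splits)
  ultimately show ?thesis by (simp add: D_def)
qed

text \<open>On subsets of \<open>S\<close> all values lie between 0 and \<open>s\<close>, hence in
  E, and an order continuous functional turns the supremum of partial sums into the sum of a series.
  Restricting to \<open>S\<close> admits measures whose value at the whole space is
  \<open>Infty\<close>.\<close>

lemma ext_measure_scalar_measures:
  fixes \<nu> :: "'a set \<Rightarrow> 'e::ordered_real_vector ext"
  assumes N: "normal_space_ov TYPE('e)" and \<nu>: "ext_measure M \<nu>" and S: "S \<in> sets M" "\<nu> S = Fin s"
  obtains m where "scalar_measures M \<nu> S m"
proof -
  have "\<exists>e. 0 \<le> e \<and> e \<le> s \<and> \<nu> (\<Delta> \<inter> S) = Fin e" if "\<Delta> \<in> sets M" for \<Delta>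
  proof -
    have "\<nu> (\<Delta> \<inter> S) \<le> Fin s"
      using ext_measure_mono[OF \<nu>, of "\<Delta> \<inter> S" S] S that by auto
    moreover have "0 \<le> \<nu> (\<Delta> \<inter> S)"
      using \<nu> that S by (auto simp: ext_measure_def)
    ultimately show ?thesis
      by (auto simp: le_Fin_iff zero_ext_def)
  qed
  then obtain e where e: "\<And>\<Delta>. \<Delta> \<in> sets M \<Longrightarrow> 0 \<le> e \<Delta>" "\<And>\<Delta>. \<Delta> \<in> sets M \<Longrightarrow> \<nu> (\<Delta> \<inter> S) = Fin (e \<Delta>)"
    by metis
  have sup: "isLub UNIV (range (\<lambda>N. \<Sum>n\<le>N. \<nu> (B n))) (\<nu> (\<Union>n. B n))"
    if "range B \<subseteq> sets M" "disjoint_family B" for B :: "nat \<Rightarrow> 'a set"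
    using \<nu> that by (simp add: ext_measure_def)
  define m where "m x' = measure_of (space M) (sets M) (\<lambda>\<Delta>. ennreal (x' (e \<Delta>)))" for x' :: "'e \<Rightarrow> real"
  have sets_m: "sets (m x') = sets M" and space_m: "space (m x') = space M" for x'
    by (auto simp: m_def)
  have em: "emeasure (m x') \<Delta> = ennreal (x' (e \<Delta>))"
    if x': "positive_oc_functional x'" and \<Delta>: "\<Delta> \<in> sets M" for x' \<Delta>
  proof (rule emeasure_measure_of[OF m_def[of x']])
    have lin: "linear x'" by (rule positive_oc_functional_linear[OF x'])
    have pos: "0 \<le> x' (e A)" if "A \<in> sets M" for A
      using positive_oc_functional_mono[OF x' e(1)[OF that]] linear_0[OF lin] by simp
    have "e {} = 0"
      using e(2)[of "{}"] \<nu> by (simp add: ext_measure_def zero_ext_def)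
    then show "positive (sets (m x')) (\<lambda>\<Delta>. ennreal (x' (e \<Delta>)))"
      by (simp add: positive_def linear_0[OF lin])
    show "countably_additive (sets (m x')) (\<lambda>\<Delta>. ennreal (x' (e \<Delta>)))"
      unfolding countably_additive_def sets_m
    proof (intro allI impI)
      fix A :: "nat \<Rightarrow> 'a set"
      assume A: "range A \<subseteq> sets M" "disjoint_family A"
      have A': "A n \<in> sets M" for n using A(1) by auto
      have "range (\<lambda>n. A n \<inter> S) \<subseteq> sets M" "disjoint_family (\<lambda>n. A n \<inter> S)"
        using A S(1) by (auto simp: disjoint_family_on_def)
      then have "isLub UNIV (range (\<lambda>N. \<Sum>n\<le>N. \<nu> (A n \<inter> S))) (\<nu> (\<Union>n. A n \<inter> S))"
        by (rule sup)
      moreover have "(\<Union>n. A n \<inter> S) = (\<Union>n. A n) \<inter> S" by auto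
      ultimately have "isLub UNIV (range (\<lambda>N. Fin (\<Sum>n\<le>N. e (A n)))) (Fin (e (\<Union>n. A n)))"
        using A' e(2)[of "\<Union>n. A n"] by (simp add: e(2) sum_Fin sets.countable_UN)
      then have "isLub UNIV (range (\<lambda>N. \<Sum>n\<le>N. e (A n))) (e (\<Union>n. A n))"
        using isLub_Fin_image[of "range (\<lambda>N. \<Sum>n\<le>N. e (A n))"] by (simp add: image_image)
      moreover have "incseq (\<lambda>N. \<Sum>n\<le>N. e (A n))"
        using e(1)[OF A'] by (auto intro!: incseq_SucI)
      ultimately have "(\<lambda>N. x' (\<Sum>n\<le>N. e (A n))) \<longlonglongrightarrow> x' (e (\<Union>n. A n))"
        by (intro positive_oc_functional_incseq[OF x'])
      then have "(\<lambda>n. x' (e (A n))) sums x' (e (\<Union>n. A n))"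
        by (simp add: sums_def_le linear_sum[OF lin])
      then show "(\<Sum>n. ennreal (x' (e (A n)))) = ennreal (x' (e (\<Union>n. A n)))"
        using pos[OF A'] by (intro suminf_ennreal_eq)
    qed
  qed (use \<Delta> sets.space_closed in \<open>auto simp: sets_m\<close>)
  have "scalar_measures M \<nu> S m"
  proof (rule scalar_measures.intro)
    fix x' :: "'e \<Rightarrow> real" assume x': "positive_oc_functional x'"
    show "finite_measure (m x')"
      by (rule finite_measureI) (simp add: space_m em[OF x'])
    show "sets (m x') = sets M" by (rule sets_m)
  next
    fix \<Delta> assume \<Delta>: "\<Delta> \<in> sets M"
    have "measure (m x') \<Delta> = x' (e \<Delta>)" if x': "positive_oc_functional x'" for x'
      using em[OF x' \<Delta>] positive_oc_functional_mono[OF x' e(1)[OF \<Delta>]]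
        linear_0[OF positive_oc_functional_linear[OF x']] by (simp add: measure_def)
    then show "\<exists>e. \<nu> (\<Delta> \<inter> S) = Fin e \<and> (\<forall>x'. positive_oc_functional x' \<longrightarrow> measure (m x') \<Delta> = x' e)"
      using e(2)[OF \<Delta>] by blast
  qed (rule N)
  then show ?thesis by (rule that)
qed

section \<open>Positive operators into quasi-perfect spaces\<close>

lemma compactin_in_sets_borel_of: "Hausdorff_space X \<Longrightarrow> compactin X K \<Longrightarrow> K \<in> sets (borel_of X)"
  by (intro closed_in_sets_borel_of compactin_imp_closedin)

locale positive_C0_operator =
  fixes X :: "'a topology" and \<pi> :: "('a \<Rightarrow> real) \<Rightarrow> 'e::ordered_real_vector"
  assumes lc: "locally_compact_space X" and Hd: "Hausdorff_space X"
    and qp: "quasi_perfect TYPE('e)" and op: "positive_operator_C0 X \<pi>"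
begin

lemma normal: "normal_space_ov TYPE('e)"
  using qp by (simp add: quasi_perfect_def)

text \<open>Stated for all positive functionals: order continuous ones yield the measures
  \<open>m x'\<close>, but the boundedness condition in \<open>quasi_perfect\<close> ranges over all
  of them.\<close>

lemma functional:
  assumes "positive_functional x'"
  shows "C0_functional X (\<lambda>f. x' (\<pi> f))"
proof
  have lin: "linear x'" by (rule positive_functional_linear[OF assms])
  fix f g :: "'a \<Rightarrow> real" and c :: real
  assume f: "f \<in> C0 X"
  show "x' (\<pi> (\<lambda>x. c * f x)) = c * x' (\<pi> f)"
    using op f by (simp add: positive_operator_C0_def linear_scale[OF lin])
  show "0 \<le> x' (\<pi> f)" if "\<And>x. 0 \<le> f x"
    using op f that assms by (simp add: positive_operator_C0_def positive_functional_def)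
  assume "g \<in> C0 X"
  with f show "x' (\<pi> (\<lambda>x. f x + g x)) = x' (\<pi> f) + x' (\<pi> g)"
    using op by (simp add: positive_operator_C0_def linear_add[OF lin])
qed (rule lc Hd)+

lemma op_mono:
  assumes "f \<in> C0 X" "g \<in> C0 X" "\<And>x. f x \<le> g x"
  shows "\<pi> f \<le> \<pi> g"
proof (rule normal_le[OF normal])
  fix x' :: "'e \<Rightarrow> real" assume "positive_oc_functional x'"
  then have "C0_functional X (\<lambda>f. x' (\<pi> f))"
    by (intro functional) (simp add: positive_oc_functional_def)
  then show "x' (\<pi> f) \<le> x' (\<pi> g)"
    using assms by (rule C0_functional.mono)
qed

lemma op_nonneg: "f \<in> C0 X \<Longrightarrow> (\<And>x. 0 \<le> f x) \<Longrightarrow> 0 \<le> \<pi> f"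
  using op by (simp add: positive_operator_C0_def)

definition m :: "('e \<Rightarrow> real) \<Rightarrow> 'a measure"
  where "m x' = C0_functional.riesz X (\<lambda>f. x' (\<pi> f))"

context
  fixes x' :: "'e \<Rightarrow> real"
  assumes x': "positive_oc_functional x'"
begin

interpretation C0_functional X "\<lambda>f. x' (\<pi> f)"
  using x' by (intro functional) (simp add: positive_oc_functional_def)

interpretation finite_measure riesz
  by (rule finite_measure_riesz)

lemma sets_m: "sets (m x') = sets (borel_of X)"
  by (simp add: m_def)

lemma finite_measure_m: "finite_measure (m x')"
  unfolding m_def by (rule finite_measure_riesz)

lemma m_open: "openin X V \<Longrightarrow> isLub UNIV {x' (\<pi> f) |f. fun_below X f V} (measure (m x') V)"
proof (rule isLub_realI)
  assume V: "openin X V"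
  show "d \<le> measure (m x') V" if "d \<in> {x' (\<pi> f) |f. fun_below X f V}" for d
    using that om_upper by (auto simp: m_def measure_riesz_open[OF V])
  fix e :: real assume "0 < e"
  from om_approx[OF this, where V = V]
  obtain f where "fun_below X f V" "om V - e < x' (\<pi> f)" .
  then show "\<exists>d\<in>{x' (\<pi> f) |f. fun_below X f V}. measure (m x') V - e < d"
    by (auto simp: m_def measure_riesz_open[OF V])
qed

lemma m_integral:
  assumes "f \<in> C0 X"
  shows "has_bochner_integral (m x') f (x' (\<pi> f))"
  using assms by (simp add: m_def has_bochner_integral_iff C0_integrable_riesz integral_riesz)

text \<open>Compares \<open>f\<close> with the indicator of its support. For a nearly optimal
  \<open>f\<close> below an open set, this makes the support the compact set sought in
  \<open>m_inner\<close>.\<close>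

lemma m_fun_below:
  assumes "fun_below X f V"
  shows "x' (\<pi> f) \<le> measure (m x') (supp_in X f)"
proof -
  have S: "supp_in X f \<in> sets riesz"
    by (simp add: closed_in_sets_borel_of closedin_supp_in)
  have f: "f \<in> C0 X" by (rule fun_below_C0[OF assms])
  have "x' (\<pi> f) = integral\<^sup>L riesz f"
    using integral_riesz[OF f] by simp
  also have "\<dots> \<le> (\<integral>x. indicator (supp_in X f) x \<partial>riesz)"
  proof (rule integral_mono)
    show "integrable riesz (\<lambda>x. indicator (supp_in X f) x :: real)"
      using S by (intro integrable_real_indicator) (auto simp: less_top[symmetric])
    show "f x \<le> indicator (supp_in X f) x" for x
      using supp_in_zero[of x X f] f fun_below_bounds(2)[OF assms, of x]
      by (auto simp: indicator_def C0_def)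
  qed (rule C0_integrable_riesz[OF f])
  also have "\<dots> = measure (m x') (supp_in X f)"
    using sets.sets_into_space[OF S] by (simp add: m_def Int_absorb2)
  finally show ?thesis .
qed

lemma m_fun_above:
  assumes K: "compactin X K" and f: "fun_above X K f"
  shows "measure (m x') K \<le> x' (\<pi> f)"
proof -
  have S: "K \<in> sets riesz"
    using compactin_in_sets_borel_of[OF Hd K] by simp
  have C: "f \<in> C0 X" by (rule fun_above_C0[OF f])
  have "measure (m x') K = (\<integral>x. indicator K x \<partial>riesz)"
    using sets.sets_into_space[OF S] by (simp add: m_def Int_absorb2)
  also have "\<dots> \<le> integral\<^sup>L riesz f"
  proof (rule integral_mono)
    show "integrable riesz (\<lambda>x. indicator K x :: real)"
      using S by (intro integrable_real_indicator) (auto simp: less_top[symmetric])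
    show "indicator K x \<le> f x" for x
      using fun_above_bounds[OF f, of x] by (auto simp: indicator_def)
  qed (rule C0_integrable_riesz[OF C])
  also have "\<dots> = x' (\<pi> f)"
    by (rule integral_riesz[OF C])
  finally show ?thesis .
qed

lemma m_outer:
  assumes \<Delta>: "\<Delta> \<in> sets (borel_of X)"
  shows "isGlb UNIV {measure (m x') V |V. openin X V \<and> \<Delta> \<subseteq> V} (measure (m x') \<Delta>)"
proof (rule isGlb_realI)
  show "measure (m x') \<Delta> \<le> d" if "d \<in> {measure (m x') V |V. openin X V \<and> \<Delta> \<subseteq> V}" for d
    using that by (auto simp: m_def open_in_sets_borel_of intro!: finite_measure_mono)
  fix e :: real assume "0 < e"
  from riesz_outer_regular[OF \<Delta> this]
  obtain V where "openin X V" "\<Delta> \<subseteq> V" "measure riesz V < measure riesz \<Delta> + e" .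
  then show "\<exists>d\<in>{measure (m x') V |V. openin X V \<and> \<Delta> \<subseteq> V}. d < measure (m x') \<Delta> + e"
    by (auto simp: m_def)
qed

text \<open>Outer regularity supplies an open \<open>V\<close> of nearly the same measure as
  \<open>K\<close>, and a Urysohn function between \<open>K\<close> and \<open>V\<close> has
  integral at most the measure of \<open>V\<close>.\<close>

lemma m_compact:
  assumes K: "compactin X K"
  shows "isGlb UNIV {x' (\<pi> f) |f. fun_above X K f} (measure (m x') K)"
proof (rule isGlb_realI)
  show "measure (m x') K \<le> d" if "d \<in> {x' (\<pi> f) |f. fun_above X K f}" for d
    using that m_fun_above[OF K] by auto
  fix e :: real assume "0 < e"
  from riesz_outer_regular[OF compactin_in_sets_borel_of[OF Hd K] this]
  obtain V where V: "openin X V" "K \<subseteq> V" "measure riesz V < measure riesz K + e" .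
  obtain f where f: "fun_above X K f" "fun_below X f V"
    using Urysohn_Cc[OF lc Hd K V(1,2)] .
  have "x' (\<pi> f) < measure (m x') K + e"
    using om_upper[OF f(2)] V(3) by (simp add: m_def measure_riesz_open[OF V(1)])
  with f(1) show "\<exists>d\<in>{x' (\<pi> f) |f. fun_above X K f}. d < measure (m x') K + e"
    by blast
qed

lemma m_inner:
  assumes V: "openin X V"
  shows "isLub UNIV {measure (m x') K |K. compactin X K \<and> K \<subseteq> V} (measure (m x') V)"
proof (rule isLub_realI)
  show "d \<le> measure (m x') V" if "d \<in> {measure (m x') K |K. compactin X K \<and> K \<subseteq> V}" for d
    using that V by (auto simp: m_def open_in_sets_borel_of intro!: finite_measure_mono)
  fix e :: real assume "0 < e"
  from om_approx[OF this, where V = V]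
  obtain f where f: "fun_below X f V" "om V - e < x' (\<pi> f)" .
  have "measure (m x') V - e < measure (m x') (supp_in X f)"
    using m_fun_below[OF f(1)] f(2) by (simp add: m_def measure_riesz_open[OF V])
  then show "\<exists>d\<in>{measure (m x') K |K. compactin X K \<and> K \<subseteq> V}. measure (m x') V - e < d"
    using f(1) by (auto simp: fun_below_def Cc_def)
qed

end

text \<open>The set is directed by \<open>fun_below_max\<close> and bounded under each positive
  functional by \<open>om_bdd\<close>, so quasi-perfectness yields \<open>v\<close>. By order
  continuity and \<open>m_open\<close>, x'(v) and the measure of \<open>V\<close> are suprema of the
  same set of reals.\<close>

lemma fun_below_sup:
  assumes V: "openin X V"
  obtains v where "isLub UNIV {\<pi> f |f. fun_below X f V} v" "0 \<le> v"
    "\<And>x'. positive_oc_functional x' \<Longrightarrow> measure (m x') V = x' v"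
proof -
  let ?D = "{\<pi> f |f. fun_below X f V}"
  have dir: "up_directed ?D"
    unfolding up_directed_def
  proof (intro conjI ballI)
    show "?D \<noteq> {}" using fun_below_zero by auto
    fix y z assume "y \<in> ?D" "z \<in> ?D"
    then obtain f g where fg: "y = \<pi> f" "z = \<pi> g" "fun_below X f V" "fun_below X g V"
      by auto
    note h = fun_below_max[OF fg(3,4)]
    show "\<exists>w\<in>?D. y \<le> w \<and> z \<le> w"
    proof (intro bexI conjI)
      show "y \<le> \<pi> (\<lambda>x. max (f x) (g x))" "z \<le> \<pi> (\<lambda>x. max (f x) (g x))"
        unfolding fg using fg h by (auto intro!: op_mono intro: fun_below_C0)
      show "\<pi> (\<lambda>x. max (f x) (g x)) \<in> ?D"
        using h by auto
    qed
  qed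
  have nn: "0 \<le> y" if "y \<in> ?D" for y
  proof -
    from that obtain f where f: "y = \<pi> f" "fun_below X f V" by auto
    show ?thesis
      unfolding f(1) by (rule op_nonneg[OF fun_below_C0[OF f(2)] fun_below_bounds(1)[OF f(2)]])
  qed
  have "bdd_above (x' ` ?D)" if "positive_functional x'" for x'
  proof -
    have "bdd_above {x' (\<pi> f) |f. fun_below X f V}"
      by (rule C0_functional.om_bdd[OF functional[OF that]])
    moreover have "x' ` ?D = {x' (\<pi> f) |f. fun_below X f V}" by auto
    ultimately show ?thesis by simp
  qed
  with dir nn qp obtain v where v: "isLub UNIV ?D v"
    unfolding quasi_perfect_def by blast
  show thesis
  proof (rule that[OF v])
    have "0 \<le> \<pi> (\<lambda>x. 0)"
      by (rule op_nonneg[OF C0_zero]) simp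
    also have "\<dots> \<le> v"
      using v fun_below_zero unfolding isLub_UNIV_iff by blast
    finally show "0 \<le> v" .
    fix x' :: "'e \<Rightarrow> real" assume x': "positive_oc_functional x'"
    have eq: "x' ` ?D = {x' (\<pi> f) |f. fun_below X f V}" by auto
    show "measure (m x') V = x' v"
      using positive_oc_functional_isLub[OF x' dir v] unfolding eq
      by (rule isLub_UNIV_unique[OF m_open[OF x' V]])
  qed
qed

text \<open>The sets on which the real measures \<open>m x'\<close> come from one element of \<open>E\<close> form a Dynkin system.\<close>

lemma exists_value:
  assumes "\<Delta> \<in> sets (borel_of X)"
  shows "\<exists>e\<ge>0. \<forall>x'. positive_oc_functional x' \<longrightarrow> measure (m x') \<Delta> = x' e"
proof -
  \<comment> \<open>The value of the whole space serves twice: for complements, and as an upper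
    bound in E for the partial sums of a disjoint union.\<close>
  obtain t where t: "0 \<le> t" "\<And>x'. positive_oc_functional x' \<Longrightarrow> measure (m x') (topspace X) = x' t"
    using fun_below_sup[OF openin_topspace] by metis
  have "Int_stable {U. openin X U}"
    by (auto simp: Int_stable_def)
  moreover have "{U. openin X U} \<subseteq> Pow (topspace X)"
    using openin_subset by auto
  moreover have "\<Delta> \<in> sigma_sets (topspace X) {U. openin X U}"
    using assms by (simp add: sets_borel_of)
  ultimately show ?thesis
  proof (induction rule: sigma_sets_induct_disjoint)
    case (basic V)
    then show ?case using fun_below_sup[of V] by (metis mem_Collect_eq)
  next
    case empty
    have "measure (m x') {} = x' 0" if "positive_oc_functional x'" for x'
      using linear_0[OF positive_oc_functional_linear[OF that]] by simp
    then show ?case by auto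
  next
    case (compl A)
    then obtain e where e: "\<And>x'. positive_oc_functional x' \<Longrightarrow> measure (m x') A = x' e" by blast
    have eq: "measure (m x') (topspace X - A) = x' (t - e)" if x': "positive_oc_functional x'" for x'
    proof -
      interpret finite_measure "m x'" by (rule finite_measure_m[OF x'])
      have "space (m x') = topspace X"
        using sets_eq_imp_space_eq[OF sets_m[OF x']] by simp
      then show ?thesis
        using compl(1) finite_measure_compl[of A] e[OF x'] t(2)[OF x']
          linear_diff[OF positive_oc_functional_linear[OF x']]
        by (simp add: sets_m[OF x'] sets_borel_of)
    qed
    have "0 \<le> t - e"
    proof (rule normal_le[OF normal])
      fix x' :: "'e \<Rightarrow> real" assume x': "positive_oc_functional x'"
      show "x' 0 \<le> x' (t - e)"
        using linear_0[OF positive_oc_functional_linear[OF x']] by (simp flip: eq[OF x'])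
    qed
    with eq show ?case by blast
  next
    case (union A)
    then obtain e where e: "\<And>i. 0 \<le> e i"
      "\<And>i x'. positive_oc_functional x' \<Longrightarrow> measure (m x') (A i) = x' (e i)" by metis
    define b where "b n = (\<Sum>i<n. e i)" for n
    have A: "A i \<in> sets (m x')" if "positive_oc_functional x'" for x' i
      using union(2) by (auto simp: sets_m[OF that] sets_borel_of)
    have inc: "incseq b"
      using e(1) by (auto simp: b_def intro!: incseq_SucI)
    have b0: "0 \<le> b n" for n
      using e(1) by (auto simp: b_def intro: sum_nonneg)
    have sums: "(\<lambda>n. x' (b n)) \<longlonglongrightarrow> measure (m x') (\<Union>i. A i)"
      if x': "positive_oc_functional x'" for x'
    proof -
      interpret finite_measure "m x'" by (rule finite_measure_m[OF x'])
      have "(\<lambda>i. measure (m x') (A i)) sums measure (m x') (\<Union>i. A i)"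
        using A[OF x'] union(1) by (intro finite_measure_UNION) auto
      then show ?thesis
        by (simp add: sums_def e(2)[OF x'] b_def linear_sum[OF positive_oc_functional_linear[OF x']])
    qed
    \<comment> \<open>The bound has to hold in E: x'(e i) is known to be a measure only for order
      continuous x', whereas quasi-perfectness tests all positive functionals. Normality gives the
      inequality in E, and every positive functional preserves it.\<close>
    have bt: "b n \<le> t" for n
    proof (rule normal_le[OF normal])
      fix x' :: "'e \<Rightarrow> real" assume x': "positive_oc_functional x'"
      interpret finite_measure "m x'" by (rule finite_measure_m[OF x'])
      have "incseq (\<lambda>n. x' (b n))"
        using inc positive_oc_functional_mono[OF x'] by (auto simp: incseq_def)
      then have "x' (b n) \<le> measure (m x') (\<Union>i. A i)"
        using sums[OF x'] by (rule incseq_le)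
      also have "\<dots> \<le> measure (m x') (space (m x'))"
        by (rule bounded_measure)
      also have "\<dots> = x' t"
        using sets_eq_imp_space_eq[OF sets_m[OF x']] t(2)[OF x'] by simp
      finally show "x' (b n) \<le> x' t" .
    qed
    have "bdd_above (x' ` range b)" if x': "positive_functional x'" for x'
      using positive_functional_mono[OF x' bt] by (intro bdd_aboveI[of _ "x' t"]) auto
    then obtain s where s: "isLub UNIV (range b) s"
      using qp up_directed_incseq[OF inc] b0 unfolding quasi_perfect_def by blast
    have "measure (m x') (\<Union>i. A i) = x' s" if x': "positive_oc_functional x'" for x'
      using sums[OF x'] positive_oc_functional_incseq[OF x' inc s] by (rule LIMSEQ_unique)
    moreover have "0 \<le> s"
      using s b0 order_trans unfolding isLub_UNIV_iff by blast
    ultimately show ?case by blast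
  qed
qed

text \<open>On Borel sets \<open>normal_eq\<close> makes the witness unique, so the choice is
  immaterial.\<close>

definition val :: "'a set \<Rightarrow> 'e"
  where "val \<Delta> = (SOME e. 0 \<le> e \<and> (\<forall>x'. positive_oc_functional x' \<longrightarrow> measure (m x') \<Delta> = x' e))"

lemma
  assumes "\<Delta> \<in> sets (borel_of X)"
  shows val_nonneg: "0 \<le> val \<Delta>"
    and val_m: "positive_oc_functional x' \<Longrightarrow> x' (val \<Delta>) = measure (m x') \<Delta>"
  using someI_ex[OF exists_value[OF assms, unfolded Bex_def]] unfolding val_def by auto

section \<open>The E-valued measure and its properties\<close>

definition \<mu> :: "'a set \<Rightarrow> 'e ext"
  where "\<mu> \<Delta> = Fin (val \<Delta>)"

lemma ext_measure_\<mu>: "ext_measure (borel_of X) \<mu>"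
  unfolding ext_measure_def
proof (intro conjI ballI allI impI)
  show "0 \<le> \<mu> \<Delta>" if "\<Delta> \<in> sets (borel_of X)" for \<Delta>
    using val_nonneg[OF that] by (simp add: \<mu>_def zero_ext_def)
  have "val {} = 0"
  proof (rule normal_eq[OF normal])
    fix x' :: "'e \<Rightarrow> real" assume x': "positive_oc_functional x'"
    show "x' (val {}) = x' 0"
      using linear_0[OF positive_oc_functional_linear[OF x']] by (simp add: val_m[OF _ x'])
  qed
  then show "\<mu> {} = 0" by (simp add: \<mu>_def zero_ext_def)
  fix A :: "nat \<Rightarrow> 'a set" assume A: "range A \<subseteq> sets (borel_of X)" "disjoint_family A"
  have As: "A i \<in> sets (borel_of X)" "(\<Union>i. A i) \<in> sets (borel_of X)" for i
    using A(1) by auto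
  let ?b = "\<lambda>N. \<Sum>n\<le>N. val (A n)"
  have "isLub UNIV (range ?b) (val (\<Union>i. A i))"
  proof (rule normal_isLub[OF normal])
    fix x' :: "'e \<Rightarrow> real" assume x': "positive_oc_functional x'"
    interpret finite_measure "m x'" by (rule finite_measure_m[OF x'])
    have b: "x' (?b N) = (\<Sum>n\<le>N. measure (m x') (A n))" for N
      by (simp add: linear_sum[OF positive_oc_functional_linear[OF x']] val_m[OF As(1) x'])
    have "(\<lambda>i. measure (m x') (A i)) sums measure (m x') (\<Union>i. A i)"
      using A by (intro finite_measure_UNION) (auto simp: sets_m[OF x'])
    then have "(\<lambda>N. x' (?b N)) \<longlonglongrightarrow> x' (val (\<Union>i. A i))"
      unfolding b val_m[OF As(2) x'] by (simp add: sums_def_le)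
    moreover have "incseq (\<lambda>N. x' (?b N))"
      unfolding b by (auto intro!: incseq_SucI)
    ultimately show "isLub UNIV (x' ` range ?b) (x' (val (\<Union>i. A i)))"
      using isLub_incseq_real by (simp add: image_image)
  qed
  then have "isLub UNIV (Fin ` range ?b) (Fin (val (\<Union>i. A i)))"
    by (simp only: isLub_Fin_image)
  then show "isLub UNIV (range (\<lambda>N. \<Sum>n\<le>N. \<mu> (A n))) (\<mu> (\<Union>n. A n))"
    by (simp add: \<mu>_def sum_Fin image_image)
qed

text \<open>All values are finite, so the restricting set can be the whole space and all of
  \<open>C0 X\<close> is treated at once.\<close>

lemma scalar_measures_\<mu>: "scalar_measures (borel_of X) \<mu> (topspace X) m"
proof (rule scalar_measures.intro)
  fix \<Delta> assume \<Delta>: "\<Delta> \<in> sets (borel_of X)"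
  then have "\<Delta> \<inter> topspace X = \<Delta>"
    using sets.sets_into_space[OF \<Delta>] by auto
  with val_m[OF \<Delta>]
  show "\<exists>e. \<mu> (\<Delta> \<inter> topspace X) = Fin e \<and> (\<forall>x'. positive_oc_functional x' \<longrightarrow> measure (m x') \<Delta> = x' e)"
    by (auto simp: \<mu>_def)
qed (simp_all add: normal finite_measure_m sets_m)

text \<open>Both f and |f| lie in \<open>C0 X\<close>, so \<open>\<pi>\<close> itself supplies the
  two elements of E that \<open>order_integral_eqI\<close> asks for.\<close>

lemma represents_on_C0: "represents_on X \<mu> \<pi> (C0 X)"
  unfolding represents_on_def
proof
  interpret scalar_measures "borel_of X" \<mu> "topspace X" m
    by (rule scalar_measures_\<mu>)
  fix f assume f: "f \<in> C0 X"
  have "f \<in> borel_measurable (borel_of X)"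
    using f by (intro cont_functions_measurable) (simp add: C0_def)
  then have "order_integrable (borel_of X) \<mu> f" "order_integral (borel_of X) \<mu> f = \<pi> f"
    using m_integral f C0_abs[OF f]
    by (auto intro!: order_integral_eqI[where Q = "\<pi> (\<lambda>x. \<bar>f x\<bar>)"])
  then show "order_integrable (borel_of X) \<mu> f \<and> \<pi> f = order_integral (borel_of X) \<mu> f"
    by simp
qed

lemma isLub_val_open:
  assumes V: "openin X V"
  shows "isLub UNIV {\<pi> f |f. fun_below X f V} (val V)"
proof (rule normal_isLub[OF normal])
  fix x' :: "'e \<Rightarrow> real" assume x': "positive_oc_functional x'"
  have "x' ` {\<pi> f |f. fun_below X f V} = {x' (\<pi> f) |f. fun_below X f V}" by auto
  then show "isLub UNIV (x' ` {\<pi> f |f. fun_below X f V}) (x' (val V))"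
    using m_open[OF x' V] val_m[OF open_in_sets_borel_of[OF V] x'] by simp
qed

lemma isGlb_val_compact:
  assumes K: "compactin X K"
  shows "isGlb UNIV {\<pi> f |f. fun_above X K f} (val K)"
proof (rule normal_isGlb[OF normal])
  fix x' :: "'e \<Rightarrow> real" assume x': "positive_oc_functional x'"
  have "x' ` {\<pi> f |f. fun_above X K f} = {x' (\<pi> f) |f. fun_above X K f}" by auto
  then show "isGlb UNIV (x' ` {\<pi> f |f. fun_above X K f}) (x' (val K))"
    using m_compact[OF x' K] val_m[OF compactin_in_sets_borel_of[OF Hd K] x'] by simp
qed

lemma inner_regular_\<mu>:
  assumes V: "openin X V"
  shows "inner_regular_at X \<mu> V"
proof -
  have "isLub UNIV {val K |K. compactin X K \<and> K \<subseteq> V} (val V)"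
  proof (rule normal_isLub[OF normal])
    fix x' :: "'e \<Rightarrow> real" assume x': "positive_oc_functional x'"
    have "x' ` {val K |K. compactin X K \<and> K \<subseteq> V} = {x' (val K) |K. compactin X K \<and> K \<subseteq> V}"
      by auto
    also have "\<dots> = {measure (m x') K |K. compactin X K \<and> K \<subseteq> V}"
      using val_m[OF compactin_in_sets_borel_of[OF Hd] x'] by (intro Collect_cong ex_cong1) auto
    finally show "isLub UNIV (x' ` {val K |K. compactin X K \<and> K \<subseteq> V}) (x' (val V))"
      using m_inner[OF x' V] val_m[OF open_in_sets_borel_of[OF V] x'] by simp
  qed
  then have "isLub UNIV (Fin ` {val K |K. compactin X K \<and> K \<subseteq> V}) (Fin (val V))"
    by (simp only: isLub_Fin_image)
  moreover have "Fin ` {val K |K. compactin X K \<and> K \<subseteq> V} = {\<mu> K |K. compactin X K \<and> K \<subseteq> V}"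
    by (auto simp: \<mu>_def)
  ultimately show ?thesis
    by (simp add: inner_regular_at_def \<mu>_def)
qed

lemma outer_regular_\<mu>:
  assumes \<Delta>: "\<Delta> \<in> sets (borel_of X)"
  shows "outer_regular_at X \<mu> \<Delta>"
proof -
  have "isGlb UNIV {val V |V. openin X V \<and> \<Delta> \<subseteq> V} (val \<Delta>)"
  proof (rule normal_isGlb[OF normal])
    fix x' :: "'e \<Rightarrow> real" assume x': "positive_oc_functional x'"
    have "x' ` {val V |V. openin X V \<and> \<Delta> \<subseteq> V} = {x' (val V) |V. openin X V \<and> \<Delta> \<subseteq> V}"
      by auto
    also have "\<dots> = {measure (m x') V |V. openin X V \<and> \<Delta> \<subseteq> V}"
      using val_m[OF open_in_sets_borel_of x'] by (intro Collect_cong ex_cong1) auto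
    finally show "isGlb UNIV (x' ` {val V |V. openin X V \<and> \<Delta> \<subseteq> V}) (x' (val \<Delta>))"
      using m_outer[OF x' \<Delta>] val_m[OF \<Delta> x'] by simp
  qed
  \<comment> \<open>The whole space is an open superset; nonemptiness is what
    \<open>isGlb_Fin_image\<close> demands.\<close>
  moreover have "{val V |V. openin X V \<and> \<Delta> \<subseteq> V} \<noteq> {}"
    using sets.sets_into_space[OF \<Delta>] by auto
  ultimately have "isGlb UNIV (Fin ` {val V |V. openin X V \<and> \<Delta> \<subseteq> V}) (Fin (val \<Delta>))"
    by (rule isGlb_Fin_image[THEN iffD2, rotated])
  moreover have "Fin ` {val V |V. openin X V \<and> \<Delta> \<subseteq> V} = {\<mu> V |V. openin X V \<and> \<Delta> \<subseteq> V}"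
    by (auto simp: \<mu>_def)
  ultimately show ?thesis
    by (simp add: outer_regular_at_def \<mu>_def)
qed

lemma regular_\<mu>: "regular_borel_ext_measure X \<mu>"
  using ext_measure_\<mu> inner_regular_\<mu> outer_regular_\<mu>
  by (auto simp: regular_borel_ext_measure_def borel_ext_measure_def \<mu>_def)

text \<open>The support \<open>S\<close> of \<open>f\<close> is compact, hence of finite value, and
  the scalar components of \<open>\<nu>\<close> on \<open>S\<close> compute the order integral of
  \<open>f\<close> even if \<open>\<nu>\<close> is infinite elsewhere. Comparing \<open>f\<close>
  with the indicators of \<open>S\<close> and \<open>K\<close> gives the two bounds.\<close>

lemma representing_sandwich:
  fixes \<nu> :: "'a set \<Rightarrow> 'e ext"
  assumes \<nu>: "regular_borel_ext_measure X \<nu>" "represents_on X \<nu> \<pi> (Cc X)"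
    and V: "openin X V" and f: "fun_below X f V"
  shows "Fin (\<pi> f) \<le> \<nu> V"
    and "compactin X K \<Longrightarrow> (\<And>x. x \<in> K \<Longrightarrow> f x = 1) \<Longrightarrow> \<nu> K \<le> Fin (\<pi> f)"
proof -
  define S where "S = supp_in X f"
  have fC: "f \<in> Cc X" and fc: "f \<in> cont_functions X" and Sc: "compactin X S"
    and f0: "\<And>x. 0 \<le> f x" and f1: "\<And>x. f x \<le> 1"
    using f fun_below_bounds[OF f] by (auto simp: fun_below_def Cc_def S_def)
  have fz: "f x = 0" if "x \<notin> S" for x
    using supp_in_zero[OF _ fc] that by (simp add: S_def)
  have fm: "f \<in> borel_measurable (borel_of X)"
    by (rule cont_functions_measurable[OF fc])
  have em: "ext_measure (borel_of X) \<nu>" and "\<exists>s. \<nu> S = Fin s"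
    using \<nu>(1) Sc by (auto simp: regular_borel_ext_measure_def borel_ext_measure_def)
  then obtain s where s: "\<nu> S = Fin s" by blast
  have Ss: "S \<in> sets (borel_of X)"
    by (rule compactin_in_sets_borel_of[OF Hd Sc])
  obtain n where n: "scalar_measures (borel_of X) \<nu> S n"
    using ext_measure_scalar_measures[OF normal em Ss s] .
  interpret scalar_measures "borel_of X" \<nu> S n by (rule n)
  obtain e where e: "has_nn_order_integral (borel_of X) \<nu> (\<lambda>x. ennreal \<bar>f x\<bar>) (Fin e)"
    using \<nu>(2) fC by (auto simp: represents_on_def order_integrable_def)
  have I: "has_bochner_integral (n x') f (x' e)" if "positive_oc_functional x'" for x'
    using e has_nn_order_integral_Fin_iff[of f e] fm f0 fz that by simp
  \<comment> \<open>\<open>f\<close> is nonnegative, so the integral \<open>e\<close> of |f| is also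
    that of \<open>f\<close>.\<close>
  have "order_integral (borel_of X) \<nu> f = e"
    using fm fz I f0 by (intro order_integral_eqI(2)[where Q = e]) auto
  then have \<pi>: "\<pi> f = e"
    using \<nu>(2) fC by (simp add: represents_on_def)
  have ind: "integrable (n x') (\<lambda>x. indicator A x :: real)"
    "(\<integral>x. indicator A x \<partial>n x') = measure (n x') A"
    if x': "positive_oc_functional x'" and A: "A \<in> sets (borel_of X)" for x' A
  proof -
    interpret finite_measure "n x'" by (rule finite_m[OF x'])
    have "A \<in> sets (n x')" using A by (simp add: scalar_measures.sets_m[OF n x'])
    then show "integrable (n x') (\<lambda>x. indicator A x :: real)"
      by (intro integrable_real_indicator) (auto simp: less_top[symmetric])
    show "(\<integral>x. indicator A x \<partial>n x') = measure (n x') A"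
      using sets.sets_into_space[OF \<open>A \<in> sets (n x')\<close>] by (simp add: Int_absorb2)
  qed
  have mS: "measure (n x') S = x' s" if "positive_oc_functional x'" for x'
    using scalar_value[OF Ss] s that by auto
  have "\<pi> f \<le> s"
  proof (rule normal_le[OF normal])
    fix x' :: "'e \<Rightarrow> real" assume x': "positive_oc_functional x'"
    have "x' (\<pi> f) = integral\<^sup>L (n x') f"
      using has_bochner_integral_integral_eq[OF I[OF x']] \<pi> by simp
    also have "\<dots> \<le> (\<integral>x. indicator S x \<partial>n x')"
      using I[OF x'] f1 fz
      by (intro integral_mono ind(1)[OF x' Ss]) (auto simp: has_bochner_integral_iff indicator_def)
    also have "\<dots> = x' s"
      using ind(2)[OF x' Ss] mS[OF x'] by simp
    finally show "x' (\<pi> f) \<le> x' s" .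
  qed
  then have "Fin (\<pi> f) \<le> \<nu> S" by (simp add: s)
  also have "\<nu> S \<le> \<nu> V"
    using f by (intro ext_measure_mono[OF em Ss open_in_sets_borel_of[OF V]]) (simp add: S_def fun_below_def)
  finally show "Fin (\<pi> f) \<le> \<nu> V" .
  assume K: "compactin X K" and fK: "\<And>x. x \<in> K \<Longrightarrow> f x = 1"
  have Ks: "K \<in> sets (borel_of X)"
    by (rule compactin_in_sets_borel_of[OF Hd K])
  \<comment> \<open>\<open>f\<close> is 1 on \<open>K\<close> and 0 off \<open>S\<close>, so the
    measures restricted to \<open>S\<close> see all of \<open>K\<close>.\<close>
  have "K \<inter> S = K"
    using fK fz by force
  then obtain k where k: "\<nu> K = Fin k" "\<And>x'. positive_oc_functional x' \<Longrightarrow> measure (n x') K = x' k"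
    using scalar_value[OF Ks] by auto
  have "k \<le> \<pi> f"
  proof (rule normal_le[OF normal])
    fix x' :: "'e \<Rightarrow> real" assume x': "positive_oc_functional x'"
    have "x' k = (\<integral>x. indicator K x \<partial>n x')"
      using ind(2)[OF x' Ks] k(2)[OF x'] by simp
    also have "\<dots> \<le> integral\<^sup>L (n x') f"
      using I[OF x'] f0 fK
      by (intro integral_mono ind(1)[OF x' Ks]) (auto simp: has_bochner_integral_iff indicator_def)
    also have "\<dots> = x' (\<pi> f)"
      using has_bochner_integral_integral_eq[OF I[OF x']] \<pi> by simp
    finally show "x' k \<le> x' (\<pi> f)" .
  qed
  then show "\<nu> K \<le> Fin (\<pi> f)" by (simp add: k(1))
qed

lemma representing_open:
  fixes \<nu> :: "'a set \<Rightarrow> 'e ext"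
  assumes \<nu>: "regular_borel_ext_measure X \<nu>" "represents_on X \<nu> \<pi> (Cc X)" and V: "openin X V"
  shows "\<nu> V = \<mu> V"
proof (rule antisym)
  have L: "isLub UNIV {\<nu> K |K. compactin X K \<and> K \<subseteq> V} (\<nu> V)"
    using \<nu>(1) V by (simp add: regular_borel_ext_measure_def inner_regular_at_def)
  have "\<nu> K \<le> Fin (val V)" if K: "compactin X K" "K \<subseteq> V" for K
  proof -
    obtain f where f: "fun_above X K f" "fun_below X f V"
      using Urysohn_Cc[OF lc Hd K(1) V K(2)] .
    have "\<nu> K \<le> Fin (\<pi> f)"
      using representing_sandwich(2)[OF \<nu> V f(2) K(1)] fun_above_bounds(3)[OF f(1)] by blast
    also have "\<pi> f \<le> val V"
      using isLub_val_open[OF V] f(2) unfolding isLub_UNIV_iff by blast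
    then have "Fin (\<pi> f) \<le> Fin (val V)" by simp
    finally show ?thesis .
  qed
  then have "\<forall>d\<in>{\<nu> K |K. compactin X K \<and> K \<subseteq> V}. d \<le> Fin (val V)"
    by blast
  with L show le: "\<nu> V \<le> \<mu> V"
    unfolding isLub_UNIV_iff \<mu>_def by blast
  \<comment> \<open>The inequality just proved makes \<open>\<nu> V\<close> finite; only now can it
    be compared in E with the least upper bound \<open>val V\<close>.\<close>
  then obtain w where w: "\<nu> V = Fin w"
    by (auto simp: \<mu>_def le_Fin_iff)
  have "\<forall>d\<in>{\<pi> f |f. fun_below X f V}. d \<le> w"
    using representing_sandwich(1)[OF \<nu> V] by (auto simp: w)
  with isLub_val_open[OF V] have "val V \<le> w"
    unfolding isLub_UNIV_iff by blast
  then show "\<mu> V \<le> \<nu> V" by (simp add: w \<mu>_def)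
qed

lemma representing_unique:
  fixes \<nu> :: "'a set \<Rightarrow> 'e ext"
  assumes \<nu>: "regular_borel_ext_measure X \<nu>" "represents_on X \<nu> \<pi> (Cc X)"
    and \<Delta>: "\<Delta> \<in> sets (borel_of X)"
  shows "\<nu> \<Delta> = \<mu> \<Delta>"
proof -
  have eq: "{\<nu> V |V. openin X V \<and> \<Delta> \<subseteq> V} = {\<mu> V |V. openin X V \<and> \<Delta> \<subseteq> V}"
    using representing_open[OF \<nu>(1,2)] by (intro Collect_cong ex_cong1) auto
  have "isGlb UNIV {\<nu> V |V. openin X V \<and> \<Delta> \<subseteq> V} (\<nu> \<Delta>)"
    using \<nu>(1) \<Delta> by (simp add: regular_borel_ext_measure_def outer_regular_at_def)
  moreover have "isGlb UNIV {\<mu> V |V. openin X V \<and> \<Delta> \<subseteq> V} (\<mu> \<Delta>)"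
    using outer_regular_\<mu>[OF \<Delta>] by (simp add: outer_regular_at_def)
  ultimately show ?thesis
    unfolding eq by (rule isGlb_UNIV_unique)
qed

end

theorem theorem6p8:
  fixes X :: "'a topology"
    and \<pi> :: "('a \<Rightarrow> real) \<Rightarrow> 'e::ordered_real_vector"
  assumes "locally_compact_space X" and "Hausdorff_space X"
    and "quasi_perfect TYPE('e)"
    and "positive_operator_C0 X \<pi>"
  shows "\<exists>\<mu> :: 'a set \<Rightarrow> 'e ext.
    regular_borel_ext_measure X \<mu> \<and> represents_on X \<mu> \<pi> (Cc X) \<and>
    (\<forall>\<nu> :: 'a set \<Rightarrow> 'e ext.
       regular_borel_ext_measure X \<nu> \<and> represents_on X \<nu> \<pi> (Cc X) \<longrightarrow>
       (\<forall>\<Delta>\<in>sets (borel_of X). \<nu> \<Delta> = \<mu> \<Delta>)) \<and>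
    finite_ext_measure (borel_of X) \<mu> \<and>
    represents_on X \<mu> \<pi> (C0 X) \<and>
    (\<forall>V. openin X V \<and> V \<noteq> {} \<longrightarrow>
       (\<exists>v. \<mu> V = Fin v \<and> isLub UNIV {\<pi> f |f. fun_below X f V} v)) \<and>
    (\<forall>K. compactin X K \<longrightarrow>
       (\<exists>k. \<mu> K = Fin k \<and> isGlb UNIV {\<pi> f |f. fun_above X K f} k))"
proof -
  interpret positive_C0_operator X \<pi>
    using assms by unfold_locales
  have "represents_on X \<mu> \<pi> (Cc X)"
    using represents_on_C0 Cc_subset_C0[of X] by (auto simp: represents_on_def)
  moreover have "finite_ext_measure (borel_of X) \<mu>"
    using val_nonneg[OF open_in_sets_borel_of[OF openin_topspace]]
    by (auto simp: finite_ext_measure_def \<mu>_def)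
  moreover have "\<forall>V. openin X V \<and> V \<noteq> {} \<longrightarrow>
       (\<exists>v. \<mu> V = Fin v \<and> isLub UNIV {\<pi> f |f. fun_below X f V} v)"
    using isLub_val_open by (simp add: \<mu>_def)
  moreover have "\<forall>K. compactin X K \<longrightarrow>
       (\<exists>k. \<mu> K = Fin k \<and> isGlb UNIV {\<pi> f |f. fun_above X K f} k)"
    using isGlb_val_compact by (simp add: \<mu>_def)
  ultimately show ?thesis
    using regular_\<mu> represents_on_C0 representing_unique by (intro exI[of _ \<mu>]) blast
qed

end
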